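(* Let $\hat{A} \in \mathbb{D}\mathbb{C}^{m \times q}$ and $\hat{B} \in \mathbb{D}\mathbb{C}^{q \times n}$ be dual complex matrices. If $$\hat{A}^N\hat{A}\hat{B}\hat{B}^N=\hat{B}\hat{B}^N\hat{A}^N\hat{A},$$ $$(\hat{A}\hat{B}\hat{B}^N\hat{A}^N)^*=\hat{A}\hat{B}\hat{B}^N\hat{A}^N,$$ $$(\hat{B}^N\hat{A}^N\hat{A}\hat{B})^*=\hat{B}^N\hat{A}^N\hat{A}\hat{B},$$ then $(\hat{A}\hat{B})^N=\hat{B}^N\hat{A}^N$.
   Context: A dual complex number is $\hat a=a_s+a_d\epsilon$ with $a_s,a_d\in\mathbb{C}$, where $\epsilon$ commutes with complex numbers and $\epsilon^2=0$; it is a dual number if $a_s,a_d\in\mathbb{R}$. A dual number is positive appreciable if $a_s>0$, and positive infinitesimal if $a_s=0$ and $a_d>0$. $\mathbb{D}\mathbb{C}^{m\times n}$ is the set of $m\times n$ dual complex matrices $\hat A=A_s+A_d\epsilon$, $A_s,A_d\in\mathbb{C}^{m\times n}$, and $\hat A^*=A_s^*+A_d^*\epsilon$ (conjugate transpose). $\hat U$ (square) is unitary if $\hat U^*\hat U=\hat U\hat U^*=I$. Known fact (SVD): every $\hat A\in\mathbb{D}\mathbb{C}^{m\times n}$ can be written $\hat A=\hat U\begin{bmatrix}\hat\Sigma_1&O\\O&\hat\Sigma_2\end{bmatrix}\hat V^*$ with $\hat U\in\mathbb{D}\mathbb{C}^{m\times m}$, $\hat V\in\mathbb{D}\mathbb{C}^{n\times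 n}$ unitary, $\hat\Sigma_1=\mathrm{diag}(\hat\mu_1,\dots,\hat\mu_r)$ with positive appreciable dual numbers on the diagonal, and $\hat\Sigma_2$ a (rectangular) diagonal matrix with diagonal entries that are positive infinitesimal dual numbers or zero. The essential part of $\hat A$ is $\hat A_e=\hat U\begin{bmatrix}\hat\Sigma_1&O\\O&O\end{bmatrix}\hat V^*$. The new dual Moore-Penrose inverse (NDMPI) $\hat A^N\in\mathbb{D}\mathbb{C}^{n\times m}$ of $\hat A$ is the unique $\hat X$ (known to exist for every $\hat A$) satisfying $\hat A\hat X\hat A=\hat A_e$, $\hat X\hat A\hat X=\hat X$, $(\hat A\hat X)^*=\hat A\hat X$, $(\hat X\hat A)^*=\hat X\hat A$; in terms of the SVD, $\hat A^N=\hat V\begin{bmatrix}\hat\Sigma_1^{-1}&O\\O&O\end{bmatrix}\hat U^*$. *)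

theory Defs
  imports "Jordan_Normal_Form.Matrix" "Jordan_Normal_Form.Conjugate"
begin

section \<open>Dual complex numbers\<close>

text \<open>\<open>DC a b\<close> stands for \<open>a + b\<epsilon>\<close> with \<open>\<epsilon>\<^sup>2 = 0\<close>; see \<open>DC_decomp\<close> and \<open>eps_square\<close> below.\<close>

datatype dcomplex = DC (std_part: complex) (dual_part: complex)

instantiation dcomplex :: comm_ring_1
begin

definition "0 = DC 0 0"
definition "1 = DC 1 0"
definition "x + y = DC (std_part x + std_part y) (dual_part x + dual_part y)"
definition "x - y = DC (std_part x - std_part y) (dual_part x - dual_part y)"
definition "- x = DC (- std_part x) (- dual_part x)"
definition "x * y = DC (std_part x * std_part y)
                       (std_part x * dual_part y + dual_part x * std_part y)"

instance
  by intro_classes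
    (auto simp: zero_dcomplex_def one_dcomplex_def plus_dcomplex_def minus_dcomplex_def
      uminus_dcomplex_def times_dcomplex_def algebra_simps)

end

definition dc_of_complex :: "complex \<Rightarrow> dcomplex" where
  "dc_of_complex a = DC a 0"

definition eps :: dcomplex where
  "eps = DC 0 1"

lemma eps_square: "eps * eps = 0"
  by (simp add: eps_def times_dcomplex_def zero_dcomplex_def)

lemma DC_decomp: "DC a b = dc_of_complex a + dc_of_complex b * eps"
  by (simp add: eps_def dc_of_complex_def times_dcomplex_def plus_dcomplex_def)

text \<open>Both parts are conjugated and \<open>\<epsilon>\<close> is fixed, so that the adjoint of
  \<open>A\<^sub>s + A\<^sub>d\<epsilon>\<close> below is \<open>A\<^sub>s\<^sup>* + A\<^sub>d\<^sup>*\<epsilon>\<close>.\<close>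

instantiation dcomplex :: conjugatable_ring
begin

definition "conjugate x = DC (cnj (std_part x)) (cnj (dual_part x))"

instance
  by intro_classes
    (auto simp: conjugate_dcomplex_def zero_dcomplex_def plus_dcomplex_def
      uminus_dcomplex_def times_dcomplex_def intro: dcomplex.expand)

end

definition is_dual_number :: "dcomplex \<Rightarrow> bool" where
  "is_dual_number x \<longleftrightarrow> std_part x \<in> \<real> \<and> dual_part x \<in> \<real>"

definition pos_appreciable :: "dcomplex \<Rightarrow> bool" where
  "pos_appreciable x \<longleftrightarrow> is_dual_number x \<and> Re (std_part x) > 0"

definition pos_infinitesimal :: "dcomplex \<Rightarrow> bool" where
  "pos_infinitesimal x \<longleftrightarrow> is_dual_number x \<and> std_part x = 0 \<and> Re (dual_part x) > 0"


section \<open>Dual complex matrices\<close>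

definition adj :: "dcomplex mat \<Rightarrow> dcomplex mat" where
  "adj A = transpose_mat (map_mat conjugate A)"

definition unitary_mat :: "nat \<Rightarrow> dcomplex mat \<Rightarrow> bool" where
  "unitary_mat n U \<longleftrightarrow> U \<in> carrier_mat n n \<and> adj U * U = 1\<^sub>m n \<and> U * adj U = 1\<^sub>m n"

definition is_svd ::
  "dcomplex mat \<Rightarrow> dcomplex mat \<Rightarrow> nat \<Rightarrow> (nat \<Rightarrow> dcomplex) \<Rightarrow> dcomplex mat \<Rightarrow> dcomplex mat \<Rightarrow> bool"
where
  "is_svd A U r \<mu> S2 V \<longleftrightarrow>
    (let m = dim_row A; n = dim_col A in
      unitary_mat m U \<and> unitary_mat n V \<and> r \<le> m \<and> r \<le> n \<and>
      (\<forall>i<r. pos_appreciable (\<mu> i)) \<and>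
      S2 \<in> carrier_mat (m - r) (n - r) \<and> diagonal_mat S2 \<and>
      (\<forall>i < min (m - r) (n - r). pos_infinitesimal (S2 $$ (i, i)) \<or> S2 $$ (i, i) = 0) \<and>
      A = U * four_block_mat (mat_diag r \<mu>) (0\<^sub>m r (n - r)) (0\<^sub>m (m - r) r) S2 * adj V)"

definition is_essential_part :: "dcomplex mat \<Rightarrow> dcomplex mat \<Rightarrow> bool" where
  "is_essential_part A E \<longleftrightarrow>
    (let m = dim_row A; n = dim_col A in
      \<exists>U r \<mu> S2 V. is_svd A U r \<mu> S2 V \<and>
        E = U * four_block_mat (mat_diag r \<mu>) (0\<^sub>m r (n - r)) (0\<^sub>m (m - r) r) (0\<^sub>m (m - r) (n - r))
              * adj V)"

text \<open>Every dual complex matrix has a singular value decomposition, and the essential part does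
  not depend on the one chosen: with \<open>P\<close>, \<open>Q\<close> the orthogonal projectors onto the ranges
  of \<open>A\<^sub>s\<close> and \<open>A\<^sub>s\<^sup>*\<close>, it is always \<open>A - (I - P) A\<^sub>d (I - Q) \<epsilon>\<close>. Hence the description below is proper.\<close>

definition essential_part :: "dcomplex mat \<Rightarrow> dcomplex mat" where
  "essential_part A = (THE E. is_essential_part A E)"

definition is_ndmpi :: "dcomplex mat \<Rightarrow> dcomplex mat \<Rightarrow> bool" where
  "is_ndmpi A X \<longleftrightarrow>
    X \<in> carrier_mat (dim_col A) (dim_row A) \<and>
    A * X * A = essential_part A \<and>
    X * A * X = X \<and>
    adj (A * X) = A * X \<and>
    adj (X * A) = X * A"

definition ndmpi :: "dcomplex mat \<Rightarrow> dcomplex mat" where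
  "ndmpi A = (THE X. is_ndmpi A X)"

end

(* Call X a weak inverse of A if X A X = X, A X and X A are Hermitian, and A X A agrees with A in the
  standard part. The SVD provides one. Two weak inverses X, Y of A have projections A X, A Y with equal
  standard parts, and likewise X A, Y A; as products of two infinitesimal matrices vanish, this forces
  A X A = A Y A and then X = Y. Hence A X A is the essential part of A, whichever SVD is used, and the
  NDMPI is the unique weak inverse. The three hypotheses say that B^N A^N is a weak inverse of A B, where
  the commutation of the projections gives A B B^N A^N A B = A_e B_e, which has the right standard part.

  An SVD of a dual matrix is obtained by deflating singular pairs until the remaining block is
  infinitesimal, and then deflating the dual part of that block. Singular pairs come from dual
  eigenvectors of the Hermitian matrix H = A^* A: for an eigenvalue l of its standard part, choose a unit
  eigenvector y of the compression of the dual part of H to the l-eigenspace, and correct y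
  infinitesimally in the orthogonal complement, on which the standard part of H - l is invertible. *)

theory Submission
  imports Defs "Jordan_Normal_Form.Spectral_Radius"
begin

section \<open>Dual complex numbers and adjoints\<close>

lemma dcomplex_eq_iff: "x = y \<longleftrightarrow> std_part x = std_part y \<and> dual_part x = dual_part y"
  by (auto intro: dcomplex.expand)

lemma std_part_simps [simp]:
  "std_part 0 = 0" "std_part 1 = 1" "std_part (x + y) = std_part x + std_part y"
  "std_part (x - y) = std_part x - std_part y" "std_part (- x) = - std_part x"
  "std_part (x * y) = std_part x * std_part y" "std_part (conjugate x) = cnj (std_part x)"
  by (simp_all add: zero_dcomplex_def one_dcomplex_def plus_dcomplex_def minus_dcomplex_def
      uminus_dcomplex_def times_dcomplex_def conjugate_dcomplex_def)

lemma dual_part_simps [simp]: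
  "dual_part 0 = 0" "dual_part 1 = 0" "dual_part (x + y) = dual_part x + dual_part y"
  "dual_part (x - y) = dual_part x - dual_part y" "dual_part (- x) = - dual_part x"
  "dual_part (x * y) = std_part x * dual_part y + dual_part x * std_part y"
  "dual_part (conjugate x) = cnj (dual_part x)"
  by (simp_all add: zero_dcomplex_def one_dcomplex_def plus_dcomplex_def minus_dcomplex_def
      uminus_dcomplex_def times_dcomplex_def conjugate_dcomplex_def)

lemma conjugate_one_dcomplex [simp]: "conjugate (1 :: dcomplex) = 1"
  by (simp add: dcomplex_eq_iff)

lemma conjugate_minus_dcomplex: "conjugate (x - y :: dcomplex) = conjugate x - conjugate y"
  by (simp add: dcomplex_eq_iff)

lemma std_part_sum [simp]: "std_part (sum f I) = (\<Sum>i\<in>I. std_part (f i))"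
  by (induction I rule: infinite_finite_induct) auto

lemma dual_part_sum [simp]: "dual_part (sum f I) = (\<Sum>i\<in>I. dual_part (f i))"
  by (induction I rule: infinite_finite_induct) auto

interpretation std: comm_ring_hom std_part
  by unfold_locales auto

text \<open>The geometric series for the inverse of a + b \<epsilon> stops after its linear term
  because the square of \<epsilon> is 0; only the standard part has to be inverted.\<close>

lemma inverse_dcomplex_ex:
  assumes "std_part x \<noteq> 0"
  obtains y where "x * y = 1"
proof
  show "x * DC (inverse (std_part x)) (- dual_part x / (std_part x)\<^sup>2) = 1"
    using assms by (simp add: dcomplex_eq_iff field_simps power2_eq_square)
qed

text \<open>Side conditions on dimensions alone can be discharged by rewriting, so this serves as a
  simplification rule that reassociates long products of rectangular matrices.\<close>

lemma assoc_mult_mat_dim: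
  "dim_col A = dim_row B \<Longrightarrow> dim_col B = dim_row C \<Longrightarrow> A * B * C = A * (B * C)"
  for A :: "'a :: semiring_0 mat"
  by (rule assoc_mult_mat[of A "dim_row A" "dim_col A" _ "dim_col B" _ "dim_col C"]) auto

lemma dim_mat_diag [simp]: "dim_row (mat_diag n f) = n" "dim_col (mat_diag n f) = n"
  by (simp_all add: mat_diag_def)

section \<open>Adjoints of dual matrices: entries, products, blocks and inner products\<close>

lemma dim_adj [simp]: "dim_row (adj A) = dim_col A" "dim_col (adj A) = dim_row A"
  by (auto simp: adj_def)

lemma adj_carrier [simp]: "adj A \<in> carrier_mat n m \<longleftrightarrow> A \<in> carrier_mat m n"
  unfolding carrier_mat_def mem_Collect_eq dim_adj by (rule conj_commute)

lemma adj_index [simp]: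
  "i < dim_col A \<Longrightarrow> j < dim_row A \<Longrightarrow> adj A $$ (i, j) = conjugate (A $$ (j, i))"
  by (simp add: adj_def)

lemma adj_adj [simp]: "adj (adj A) = A"
  by (rule eq_matI) auto

lemma adj_zero [simp]: "adj (0\<^sub>m m n) = 0\<^sub>m n m"
  by (rule eq_matI) auto

lemma adj_one [simp]: "adj (1\<^sub>m n) = 1\<^sub>m n"
  by (rule eq_matI) auto

lemma adj_mult:
  assumes "A \<in> carrier_mat m k" "B \<in> carrier_mat k n"
  shows "adj (A * B) = adj B * adj A"
proof (rule eq_matI)
  fix i j assume "i < dim_row (adj B * adj A)" "j < dim_col (adj B * adj A)"
  then have ij: "i < n" "j < m" using assms by auto
  have "adj (A * B) $$ (i, j) = conjugate (\<Sum>l = 0..<k. A $$ (j, l) * B $$ (l, i))"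
    using assms ij by (simp add: scalar_prod_def)
  also have "\<dots> = (\<Sum>l = 0..<k. conjugate (B $$ (l, i)) * conjugate (A $$ (j, l)))"
    by (subst sum_conjugate) (auto simp only: conjugate_dist_mul mult.commute finite_atLeastLessThan)
  also have "\<dots> = (adj B * adj A) $$ (i, j)"
    using assms ij by (simp add: scalar_prod_def)
  finally show "adj (A * B) $$ (i, j) = (adj B * adj A) $$ (i, j)" .
qed (use assms in auto)

lemma adj_four_block_mat:
  assumes "A \<in> carrier_mat k l" "B \<in> carrier_mat k n" "C \<in> carrier_mat m l" "D \<in> carrier_mat m n"
  shows "adj (four_block_mat A B C D) = four_block_mat (adj A) (adj C) (adj B) (adj D)"
  unfolding adj_def map_four_block_mat[OF assms]
  by (rule transpose_four_block_mat) (use assms in auto)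

lemma adj_mult_cscalar_prod:
  assumes "A \<in> carrier_mat m n" "v \<in> carrier_vec n" "w \<in> carrier_vec m"
  shows "(A *\<^sub>v v) \<bullet>c w = v \<bullet>c (adj A *\<^sub>v w)"
proof -
  have "(A *\<^sub>v v) \<bullet>c w = (\<Sum>i = 0..<m. \<Sum>j = 0..<n. A $$ (i, j) * v $ j * conjugate (w $ i))"
    using assms by (auto simp: scalar_prod_def sum_distrib_right intro!: sum.cong)
  also have "\<dots> = (\<Sum>j = 0..<n. \<Sum>i = 0..<m. A $$ (i, j) * v $ j * conjugate (w $ i))"
    by (rule sum.swap)
  also have "\<dots> = v \<bullet>c (adj A *\<^sub>v w)"
    using assms by (auto simp: scalar_prod_def sum_distrib_left sum_conjugate conjugate_dist_mul
        mult_ac intro!: sum.cong)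
  finally show ?thesis .
qed

section \<open>Unitary matrices\<close>

lemma unitary_matD:
  assumes "unitary_mat n U"
  shows "U \<in> carrier_mat n n" "adj U \<in> carrier_mat n n" "adj U * U = 1\<^sub>m n" "U * adj U = 1\<^sub>m n"
  using assms by (auto simp: unitary_mat_def)

lemma unitary_mat_one: "unitary_mat n (1\<^sub>m n)"
  by (simp add: unitary_mat_def)

lemma unitary_mat_cancel:
  assumes "unitary_mat n U" "A \<in> carrier_mat n k"
  shows "adj U * (U * A) = A" "U * (adj U * A) = A"
proof -
  note U = unitary_matD[OF assms(1)]
  show "adj U * (U * A) = A"
    unfolding assoc_mult_mat[OF U(2,1) assms(2), symmetric] U(3) using assms(2) by (rule left_mult_one_mat)
  show "U * (adj U * A) = A"
    unfolding assoc_mult_mat[OF U(1,2) assms(2), symmetric] U(4) using assms(2) by (rule left_mult_one_mat)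
qed

lemma unitary_mat_mult:
  assumes "unitary_mat n U" "unitary_mat n W"
  shows "unitary_mat n (U * W)"
proof -
  note U = unitary_matD[OF assms(1)] and W = unitary_matD[OF assms(2)]
  have "adj W * adj U * (U * W) = adj W * (adj U * (U * W))"
    using U W by (intro assoc_mult_mat) auto
  also have "\<dots> = 1\<^sub>m n"
    unfolding unitary_mat_cancel(1)[OF assms(1) W(1)] by (rule W)
  finally have 1: "adj W * adj U * (U * W) = 1\<^sub>m n" .
  have "U * W * (adj W * adj U) = U * (W * (adj W * adj U))"
    using U W by (intro assoc_mult_mat) auto
  also have "\<dots> = 1\<^sub>m n"
    unfolding unitary_mat_cancel(2)[OF assms(2) U(2)] by (rule U)
  finally show ?thesis
    using 1 mult_carrier_mat[OF U(1) W(1)] by (simp only: unitary_mat_def adj_mult[OF U(1) W(1)])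
qed

section \<open>Bordered unitary matrices, and completion of a unit vector to a unitary
  matrix\<close>

lemma unitary_mat_border:
  assumes "unitary_mat n W"
  shows "unitary_mat (k + n) (four_block_mat (1\<^sub>m k) (0\<^sub>m k n) (0\<^sub>m n k) W)"
proof -
  note W = unitary_matD[OF assms]
  show ?thesis
    using W four_block_carrier_mat[OF one_carrier_mat[of k] W(1)]
      mult_four_block_mat[OF one_carrier_mat[of k] zero_carrier_mat[of k n] zero_carrier_mat[of n k] W(1)
        one_carrier_mat[of k] zero_carrier_mat[of k n] zero_carrier_mat[of n k] W(2)]
      mult_four_block_mat[OF one_carrier_mat[of k] zero_carrier_mat[of k n] zero_carrier_mat[of n k] W(2)
        one_carrier_mat[of k] zero_carrier_mat[of k n] zero_carrier_mat[of n k] W(1)]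
    unfolding unitary_mat_def adj_four_block_mat[OF one_carrier_mat[of k] zero_carrier_mat[of k n]
        zero_carrier_mat[of n k] W(1)]
    by simp
qed

text \<open>Used for deflation: once \<open>A\<close> has been split off, a transformation of the
  remaining block lifts to the whole matrix without touching \<open>A\<close>.\<close>

lemma border_mult:
  fixes A :: "'a :: semiring_1 mat"
  assumes "A \<in> carrier_mat k l" "B \<in> carrier_mat k n" "C \<in> carrier_mat m l" "D \<in> carrier_mat m n"
    and "U \<in> carrier_mat m m" "V \<in> carrier_mat n n"
  shows "four_block_mat (1\<^sub>m k) (0\<^sub>m k m) (0\<^sub>m m k) U * four_block_mat A B C D *
    four_block_mat (1\<^sub>m l) (0\<^sub>m l n) (0\<^sub>m n l) V = four_block_mat A (B * V) (U * C) (U * D * V)"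
  using assms
  by (simp add: mult_four_block_mat[of _ k k _ m _ m _ _ l _ n] 
      mult_four_block_mat[of _ k l _ n _ m _ _ l _ n])

text \<open>Let w' be the conjugate row of w. The product of I - c w w' and I - d w w' is I - (c + d
  - c d w'w) w w', and the adjoint of the first factor is obtained by conjugating c. The condition
  on c makes the bracket vanish for d = \<open>conjugate c\<close>. Allowing nonreal c makes it
  possible to reach vectors whose first entry is not real.\<close>

lemma unitary_reflection:
  fixes w :: "dcomplex vec"
  assumes w: "w \<in> carrier_vec n" and c: "c + conjugate c = c * conjugate c * (w \<bullet>c w)"
  shows "unitary_mat n (mat n n (\<lambda>(i, j). (if i = j then 1 else 0) - c * w $ i * conjugate (w $ j)))"
    (is "unitary_mat n (?U c)")
proof -
  have adj: "adj (?U c) = ?U (conjugate c)" for c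
    by (rule eq_matI) (auto simp: conjugate_minus_dcomplex conjugate_dist_mul)
  have mult: "?U c * ?U d = 1\<^sub>m n" if "c + d = c * d * (w \<bullet>c w)" for c d
  proof (rule eq_matI)
    fix i j assume "i < dim_row (1\<^sub>m n)" "j < dim_col (1\<^sub>m n)"
    then have ij: "i < n" "j < n" by auto
    let ?\<delta> = "\<lambda>i j. if i = j then 1 else 0 :: dcomplex"
    have "(?U c * ?U d) $$ (i, j) = 
      (\<Sum>k = 0..<n. (?\<delta> i k - c * w $ i * conjugate (w $ k)) * (?\<delta> k j - d * w $ k * conjugate (w $ j)))"
      using ij by (simp add: scalar_prod_def)
    also have "\<dots> = (\<Sum>k = 0..<n. ?\<delta> i k * ?\<delta> k j) - (\<Sum>k = 0..<n. if i = k then d * w $ k * conjugate (w $ j) else 0)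
       - (\<Sum>k = 0..<n. if k = j then c * w $ i * conjugate (w $ k) else 0)
       + (\<Sum>k = 0..<n. c * w $ i * d * conjugate (w $ j) * (w $ k * conjugate (w $ k)))"
      unfolding sum_subtractf[symmetric] sum.distrib[symmetric]
      by (rule sum.cong) (auto simp: algebra_simps)
    also have "(\<Sum>k = 0..<n. ?\<delta> i k * ?\<delta> k j) = (\<Sum>k = 0..<n. if i = k then ?\<delta> i j else 0)"
      by (rule sum.cong) auto
    also have "(\<Sum>k = 0..<n. c * w $ i * d * conjugate (w $ j) * (w $ k * conjugate (w $ k)))
       = c * w $ i * d * conjugate (w $ j) * (w \<bullet>c w)"
      using w by (simp add: scalar_prod_def sum_distrib_left)
    also have "\<dots> = w $ i * conjugate (w $ j) * (c + d)"
      unfolding that by (simp add: algebra_simps)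
    finally show "(?U c * ?U d) $$ (i, j) = 1\<^sub>m n $$ (i, j)"
      using ij by (simp add: algebra_simps)
  qed auto
  show ?thesis
    unfolding unitary_mat_def adj
  proof (intro conjI)
    show "?U (conjugate c) * ?U c = 1\<^sub>m n"
      by (rule mult) (metis c add.commute mult.commute)
    show "?U c * ?U (conjugate c) = 1\<^sub>m n"
      by (rule mult) (rule c)
  qed simp
qed

text \<open>The reflection along \<open>unit_vec n 0 - v\<close> does it, with c the inverse of
  \<open>1 - conjugate (v $ 0)\<close>. That inverse exists unless the standard part of
  \<open>v $ 0\<close> is 1; in this case the construction is applied to \<open>- v\<close>, whose
  first entry has standard part -1, and the resulting matrix is negated.\<close>

lemma unitary_completion:
  fixes v :: "dcomplex vec"
  assumes v: "v \<in> carrier_vec n" "v \<bullet>c v = 1" and n: "0 < n"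
  shows "\<exists>U. unitary_mat n U \<and> U *\<^sub>v unit_vec n 0 = v"
proof -
  have *: "\<exists>U. unitary_mat n U \<and> U *\<^sub>v unit_vec n 0 = v"
    if v: "v \<in> carrier_vec n" "v \<bullet>c v = 1" and v0: "std_part (v $ 0) \<noteq> 1" for v :: "dcomplex vec"
  proof -
    have "std_part (1 - conjugate (v $ 0)) \<noteq> 0"
      using v0 by (simp add: complex_eq_iff)
    then obtain c where c: "(1 - conjugate (v $ 0)) * c = 1"
      by (rule inverse_dcomplex_ex)
    define w where "w = unit_vec n 0 - v"
    have w: "w \<in> carrier_vec n" using v by (simp add: w_def)
    have "w \<bullet>c w = (\<Sum>k = 0..<n. (if k = 0 then 1 - v $ 0 - conjugate (v $ 0) else 0) + v $ k * conjugate (v $ k))"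
    proof -
      have "w $ k * conjugate (w $ k) =
          (if k = 0 then 1 - v $ 0 - conjugate (v $ 0) else 0) + v $ k * conjugate (v $ k)"
        if "k < n" for k
        using that v(1) by (cases "k = 0")
          (auto simp: w_def conjugate_minus_dcomplex conjugate_neg algebra_simps)
      then show ?thesis
        using w by (auto simp: scalar_prod_def intro!: sum.cong)
    qed
    also have "\<dots> = 1 - v $ 0 - conjugate (v $ 0) + v \<bullet>c v"
      using v(1) n by (simp add: sum.distrib scalar_prod_def)
    finally have ww: "w \<bullet>c w = (1 - v $ 0) + (1 - conjugate (v $ 0))"
      using v(2) by simp
    have c': "(1 - v $ 0) * conjugate c = 1"
      using arg_cong[OF c, of conjugate] by (simp add: conjugate_minus_dcomplex conjugate_dist_mul)
    have "c * conjugate c * (w \<bullet>c w) =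
        c * ((1 - v $ 0) * conjugate c) + conjugate c * ((1 - conjugate (v $ 0)) * c)"
      unfolding ww by (simp add: algebra_simps)
    then have "c + conjugate c = c * conjugate c * (w \<bullet>c w)"
      by (simp add: c c')
    note U = unitary_reflection[OF w this]
    have w0: "conjugate (w $ 0) = 1 - conjugate (v $ 0)"
      using n v(1) by (simp add: w_def conjugate_minus_dcomplex)
    \<comment> \<open>As \<open>c\<close> inverts \<open>conjugate (w $ 0)\<close>, column 0 of the
      reflection is \<open>unit_vec n 0 - w\<close>, which is \<open>v\<close>.\<close>
    have cw: "c * x * conjugate (w $ 0) = x" for x
    proof -
      have "c * x * (1 - conjugate (v $ 0)) = x * ((1 - conjugate (v $ 0)) * c)"
        by (simp only: mult_ac)
      with c w0 show ?thesis by simp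
    qed
    show ?thesis
    proof (intro exI conjI)
      show "mat n n (\<lambda>(i, j). (if i = j then 1 else 0) - c * w $ i * conjugate (w $ j)) *\<^sub>v unit_vec n 0 = v"
        using v n w by (intro eq_vecI) (auto simp: cw, auto simp: w_def)
    qed (rule U)
  qed
  show ?thesis
  proof (cases "std_part (v $ 0) = 1")
    case False
    then show ?thesis using * v by blast
  next
    case True
    have "(- v) \<bullet>c (- v) = 1"
      using v by (simp add: scalar_prod_def conjugate_neg)
    moreover have "std_part ((- v) $ 0) \<noteq> 1"
      using True v(1) n by simp
    ultimately obtain U where U: "unitary_mat n U" "U *\<^sub>v unit_vec n 0 = - v"
      using *[of "- v"] v(1) by auto
    have "unitary_mat n (- U)"
    proof -
      have "adj (- U) = - adj U"
        by (rule eq_matI) (auto simp: conjugate_neg)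
      then show ?thesis
        using unitary_matD[OF U(1)] by (auto simp: unitary_mat_def)
    qed
    moreover have "- U *\<^sub>v unit_vec n 0 = v"
      using U v(1) unitary_matD(1)[OF U(1)] by simp
    ultimately show ?thesis by blast
  qed
qed

lemma unitary_mult_cscalar_prod:
  assumes "unitary_mat n U" "v \<in> carrier_vec n"
  shows "(U *\<^sub>v v) \<bullet>c (U *\<^sub>v v) = v \<bullet>c v"
proof -
  note U = unitary_matD[OF assms(1)]
  have "adj U *\<^sub>v (U *\<^sub>v v) = v"
    unfolding assoc_mult_mat_vec[OF U(2,1) assms(2), symmetric] U(3) using assms(2) by simp
  then show ?thesis
    using adj_mult_cscalar_prod[OF U(1) assms(2), of "U *\<^sub>v v"] U(1) assms(2) by simp
qed

section \<open>Dual eigenvectors of Hermitian matrices\<close>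

lemma unit_eigenvector_complex:
  fixes A :: "complex mat"
  assumes A: "A \<in> carrier_mat n n" and "eigenvalue A l"
  obtains x where "x \<in> carrier_vec n" "x \<bullet>c x = 1" "A *\<^sub>v x = l \<cdot>\<^sub>v x"
proof -
  obtain y where y: "y \<in> carrier_vec n" "y \<noteq> 0\<^sub>v n" "A *\<^sub>v y = l \<cdot>\<^sub>v y"
    using assms unfolding eigenvalue_def eigenvector_def by auto
  have "y \<bullet>c y > 0"
    using y by simp
  then obtain s where s: "y \<bullet>c y = of_real s" "s > 0"
    by (intro that[of "Re (y \<bullet>c y)"]) (auto simp: less_complex_def complex_eq_iff)
  define x where "x = of_real (1 / sqrt s) \<cdot>\<^sub>v y"
  show ?thesis
  proof
    show "x \<in> carrier_vec n" using y by (simp add: x_def)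
    show "x \<bullet>c x = 1"
      using y(1) s by (simp add: x_def conjugate_smult_vec flip: of_real_mult)
    show "A *\<^sub>v x = l \<cdot>\<^sub>v x"
      using y A by (simp add: x_def mult_mat_vec smult_smult_assoc mult.commute)
  qed
qed

text \<open>\<open>char_matrix R l\<close> is R - l I, invertible when \<open>l\<close> is no
  eigenvalue. The solution \<open>z\<close> will be the infinitesimal correction of an
  eigenvector.\<close>

lemma not_eigenvalue_solve:
  fixes R :: "'a :: field mat"
  assumes R: "R \<in> carrier_mat n n" and "\<not> eigenvalue R l" and w: "w \<in> carrier_vec n"
  obtains z where "z \<in> carrier_vec n" "R *\<^sub>v z + w = l \<cdot>\<^sub>v z"
proof -
  have "det (char_matrix R l) \<noteq> 0"
    using assms eigenvalue_det by blast
  from det_non_zero_imp_unit[OF char_matrix_closed[OF R] this]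
  obtain X where X: "X \<in> carrier_mat n n" "char_matrix R l * X = 1\<^sub>m n"
    by (auto simp: Units_def ring_mat_def)
  define z where "z = X *\<^sub>v (- w)"
  have z: "z \<in> carrier_vec n" using X w by (simp add: z_def)
  have "char_matrix R l *\<^sub>v z = - w"
    unfolding z_def using w
      assoc_mult_mat_vec[OF char_matrix_closed[OF R] X(1), of "- w", symmetric] X(2) by simp
  moreover have "char_matrix R l *\<^sub>v z = R *\<^sub>v z - l \<cdot>\<^sub>v z"
    unfolding char_matrix_def using R z
    by (subst add_mult_distrib_mat_vec[where nr = n and nc = n]) (auto intro!: eq_vecI)
  ultimately have eq: "R *\<^sub>v z - l \<cdot>\<^sub>v z = - w" by simp
  have "R *\<^sub>v z + w = l \<cdot>\<^sub>v z"
  proof (rule eq_vecI)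
    fix i assume i: "i < dim_vec (l \<cdot>\<^sub>v z)"
    then show "(R *\<^sub>v z + w) $ i = (l \<cdot>\<^sub>v z) $ i"
      using arg_cong[OF eq, of "\<lambda>u. u $ i"] R z w by (simp add: algebra_simps)
  qed (use R z w in auto)
  with z show ?thesis by (rule that)
qed

lemma adj_conjugation:
  assumes "A \<in> carrier_mat n n" "adj A = A" "U \<in> carrier_mat n n"
  shows "adj (adj U * A * U) = adj U * A * U"
proof -
  have "adj (adj U * A * U) = adj U * adj (adj U * A)"
    using assms by (intro adj_mult) auto
  also have "adj (adj U * A) = A * U"
    using assms adj_mult[of "adj U" n n A n] by simp
  also have "adj U * (A * U) = adj U * A * U"
    using assms by (intro assoc_mult_mat[symmetric]) auto
  finally show ?thesis .
qed

text \<open>Eigenvectors of the standard part for \<open>l\<close> are split off one at a time, by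
  induction on the size, until \<open>l\<close> is no eigenvalue of what remains. The first
  \<open>k\<close> basis vectors then span the whole \<open>l\<close>-eigenspace of the standard
  part, and \<open>R\<close> acts on its orthogonal complement. The dual part of the transformed
  matrix stays arbitrary.\<close>

lemma eigenspace_block:
  assumes "H \<in> carrier_mat n n" "adj H = H"
  shows "\<exists>W k m R. unitary_mat n W \<and> n = k + m \<and> R \<in> carrier_mat m m \<and>
    map_mat std_part (adj W * H * W) = four_block_mat (l \<cdot>\<^sub>m 1\<^sub>m k) (0\<^sub>m k m) (0\<^sub>m m k) R \<and>
    \<not> eigenvalue R l \<and> (eigenvalue (map_mat std_part H) l \<longrightarrow> 0 < k)"
  using assms
proof (induction n arbitrary: H)
  case (Suc n)
  note H = Suc.prems
  let ?n = "Suc n"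
  show ?case
  proof (cases "eigenvalue (map_mat std_part H) l")
    case False
    have "map_mat std_part (adj (1\<^sub>m ?n) * H * 1\<^sub>m ?n) =
        four_block_mat (l \<cdot>\<^sub>m 1\<^sub>m 0) (0\<^sub>m 0 ?n) (0\<^sub>m ?n 0) (map_mat std_part H)"
      using H by (intro eq_matI) auto
    then show ?thesis
      using False H unitary_mat_one
      by (intro exI[of _ "1\<^sub>m ?n"] exI[of _ 0] exI[of _ ?n] exI[of _ "map_mat std_part H"]) auto
  next
    case True
    obtain x where x: "x \<in> carrier_vec ?n" "x \<bullet>c x = 1" "map_mat std_part H *\<^sub>v x = l \<cdot>\<^sub>v x"
      using unit_eigenvector_complex[OF _ True] H(1) by auto
    \<comment> \<open>Lifting \<open>x\<close> with zero dual part keeps it a unit vector, so it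
      extends to a dual unitary matrix.\<close>
    define v where "v = vec ?n (\<lambda>i. DC (x $ i) 0)"
    have v: "v \<in> carrier_vec ?n" "map_vec std_part v = x"
      using x(1) by (auto simp: v_def)
    have "v \<bullet>c v = 1"
      using x(1,2) by (simp add: dcomplex_eq_iff v_def scalar_prod_def)
    with v obtain U where U: "unitary_mat ?n U" "U *\<^sub>v unit_vec ?n 0 = v"
      using unitary_completion[of v ?n] by auto
    note U' = unitary_matD[OF U(1)]
    define M where "M = adj U * H * U"
    have M: "M \<in> carrier_mat ?n ?n" "adj M = M"
      using U' H adj_conjugation[OF H U'(1)] unfolding M_def by auto
    have e: "unit_vec ?n 0 \<in> carrier_vec ?n" by simp
    have Uv: "adj U *\<^sub>v v = unit_vec ?n 0"
      unfolding U(2)[symmetric] assoc_mult_mat_vec[OF U'(2,1) e, symmetric] U'(3) by simp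
    have "M *\<^sub>v unit_vec ?n 0 = adj U *\<^sub>v (H *\<^sub>v v)"
      unfolding M_def U(2)[symmetric] using U' H e
      by (simp add: assoc_mult_mat_vec[of _ ?n ?n _ ?n])
    then have "map_vec std_part (M *\<^sub>v unit_vec ?n 0) =
        map_mat std_part (adj U) *\<^sub>v (l \<cdot>\<^sub>v map_vec std_part v)"
      using H v U' x(3)
      by (simp add: std.mult_mat_vec_hom[of _ ?n ?n])
    also have "\<dots> = l \<cdot>\<^sub>v map_vec std_part (adj U *\<^sub>v v)"
      using v U' by (simp add: mult_mat_vec[of _ ?n ?n, OF _ x(1)] std.mult_mat_vec_hom[of _ ?n ?n])
    finally have Me: "map_vec std_part (M *\<^sub>v unit_vec ?n 0) = l \<cdot>\<^sub>v map_vec std_part (unit_vec ?n 0)"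
      unfolding Uv .
    have col: "std_part (M $$ (i, 0)) = (if i = 0 then l else 0)" if "i < ?n" for i
      using arg_cong[OF Me, of "\<lambda>u. u $ i"] that M(1) by (auto split: if_splits)
    \<comment> \<open>The eigenvector fixes only column 0; row 0 follows because \<open>M\<close> is
      Hermitian.\<close>
    have row: "std_part (M $$ (0, j)) = 0" if "0 < j" "j < ?n" for j
    proof -
      have "M $$ (0, j) = conjugate (M $$ (j, 0))"
        using M that by (metis adj_index carrier_matD zero_less_Suc)
      then show ?thesis using col that by simp
    qed
    obtain a b c D where sp: "split_block M 1 1 = (a, b, c, D)"
      by (metis prod_cases4)
    note blk = split_block[OF sp, of n n]
    have D: "D = mat n n (\<lambda>(i, j). M $$ (Suc i, Suc j))" 
      and b: "b = mat 1 n (\<lambda>(i, j). M $$ (i, Suc j))"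
      and c: "c = mat n 1 (\<lambda>(i, j). M $$ (Suc i, j))"
      and a: "a = mat 1 1 (\<lambda>(i, j). M $$ (i, j))"
      using sp M(1) by (auto simp: split_block_def Let_def)
    have carr: "a \<in> carrier_mat 1 1" "b \<in> carrier_mat 1 n" "c \<in> carrier_mat n 1" "D \<in> carrier_mat n n"
      and Mblk: "M = four_block_mat a b c D"
      using blk M by auto
    have std0: "map_mat std_part a = l \<cdot>\<^sub>m 1\<^sub>m 1" "map_mat std_part b = 0\<^sub>m 1 n"
      "map_mat std_part c = 0\<^sub>m n 1"
      using col row by (auto simp: a b c intro!: eq_matI)
    have "adj D = D"
    proof (rule eq_matI)
      fix i j assume "i < dim_row D" "j < dim_col D"
      then have ij: "Suc i < ?n" "Suc j < ?n" using carr by auto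
      then have "adj M $$ (Suc i, Suc j) = conjugate (M $$ (Suc j, Suc i))"
        using M(1) by simp
      then show "adj D $$ (i, j) = D $$ (i, j)"
        unfolding M(2) using ij carr by (simp add: D)
    qed (use carr in auto)
    from Suc.IH[OF carr(4) this] obtain W k m R where
      W: "unitary_mat n W" and n: "n = k + m" and R: "R \<in> carrier_mat m m" "\<not> eigenvalue R l" and
      WR: "map_mat std_part (adj W * D * W) = four_block_mat (l \<cdot>\<^sub>m 1\<^sub>m k) (0\<^sub>m k m) (0\<^sub>m m k) R"
      by blast
    note W' = unitary_matD[OF W]
    let ?B = "four_block_mat (1\<^sub>m 1) (0\<^sub>m 1 n) (0\<^sub>m n 1) W"
    have B: "unitary_mat ?n ?B" using unitary_mat_border[OF W, of 1] by simp
    note B' = unitary_matD[OF B]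
    \<comment> \<open>Conjugation by \<open>U * ?B\<close> is conjugation by \<open>U\<close>, which
      isolates the first eigenvector, followed by the bordered transformation of the remaining block
      \<open>D\<close>.\<close>
    have "adj (U * ?B) * H * (U * ?B) = adj ?B * M * ?B"
    proof -
      have "adj (U * ?B) * H * (U * ?B) = adj ?B * adj U * (H * (U * ?B))"
        unfolding adj_mult[OF U'(1) B'(1)]
        using B' U' H by (intro assoc_mult_mat[of _ ?n ?n _ ?n _ ?n]) (auto simp del: four_block_carrier_mat)
      also have "\<dots> = adj ?B * (adj U * (H * (U * ?B)))"
        using B' U' H by (intro assoc_mult_mat[of _ ?n ?n _ ?n _ ?n]) auto
      also have "H * (U * ?B) = H * U * ?B"
        using B' U' H by (intro assoc_mult_mat[of _ ?n ?n _ ?n _ ?n, symmetric]) auto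
      also have "adj U * (H * U * ?B) = adj U * (H * U) * ?B"
        using B' U' H by (intro assoc_mult_mat[of _ ?n ?n _ ?n _ ?n, symmetric]) auto
      also have "adj U * (H * U) = M"
        unfolding M_def using B' U' H by (intro assoc_mult_mat[of _ ?n ?n _ ?n _ ?n, symmetric]) auto
      also have "adj ?B * (M * ?B) = adj ?B * M * ?B"
        using B' M by (intro assoc_mult_mat[of _ ?n ?n _ ?n _ ?n, symmetric]) auto
      finally show ?thesis .
    qed
    also have "\<dots> = four_block_mat a (b * W) (adj W * c) (adj W * D * W)"
      using border_mult[OF carr W'(2,1)] adj_four_block_mat[OF one_carrier_mat[of 1] zero_carrier_mat zero_carrier_mat W'(1)]
      by (simp add: Mblk)
    finally have "map_mat std_part (adj (U * ?B) * H * (U * ?B)) =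
      four_block_mat (map_mat std_part a) (map_mat std_part (b * W)) (map_mat std_part (adj W * c))
        (map_mat std_part (adj W * D * W))"
      using carr W' by (simp add: map_four_block_mat[of _ 1 1 _ n _ n])
    also have "\<dots> = four_block_mat (l \<cdot>\<^sub>m 1\<^sub>m 1) (0\<^sub>m 1 n) (0\<^sub>m n 1)
        (four_block_mat (l \<cdot>\<^sub>m 1\<^sub>m k) (0\<^sub>m k m) (0\<^sub>m m k) R)"
      using carr W' std0
      by (simp add: std.mat_hom_mult[of _ 1 n _ n] std.mat_hom_mult[of _ n n _ 1] WR
          del: assoc_mult_mat)
    also have "\<dots> = four_block_mat (l \<cdot>\<^sub>m 1\<^sub>m (Suc k)) (0\<^sub>m (Suc k) m) (0\<^sub>m m (Suc k)) R"
      (is "?L = ?R")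
    proof (rule eq_matI)
      fix i j assume "i < dim_row ?R" "j < dim_col ?R"
      then show "?L $$ (i, j) = ?R $$ (i, j)"
        using R n by (cases i; cases j) auto
    qed (use R n in auto)
    finally show ?thesis
      using n R unitary_mat_mult[OF U(1) B]
      by (intro exI[of _ "U * ?B"] exI[of _ "Suc k"] exI[of _ m] exI[of _ R]) auto
  qed
next
  case 0
  then have "\<not> eigenvalue (map_mat std_part H) l"
    using eigenvalue_imp_nonzero_dim[of "map_mat std_part H" 0 l] by auto
  moreover have "map_mat std_part (adj (1\<^sub>m 0) * H * 1\<^sub>m 0) =
      four_block_mat (l \<cdot>\<^sub>m 1\<^sub>m 0) (0\<^sub>m 0 0) (0\<^sub>m 0 0) (map_mat std_part H)"
    using 0 by (intro eq_matI) auto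
  ultimately show ?case
    using 0 unitary_mat_one
    by (intro exI[of _ "1\<^sub>m 0"] exI[of _ 0] exI[of _ 0] exI[of _ "map_mat std_part H"]) auto
qed

section \<open>From eigenvectors of the standard part to dual eigenvectors\<close>

lemma mult_mat_zero_vec:
  "A \<in> carrier_mat m n \<Longrightarrow> A *\<^sub>v 0\<^sub>v n = (0\<^sub>v m :: 'a :: semiring_0 vec)"
  by (intro eq_vecI) auto

lemma mult_mat_smult_vec:
  fixes A :: "'a :: comm_semiring_0 mat"
  assumes "A \<in> carrier_mat m n" "v \<in> carrier_vec n"
  shows "A *\<^sub>v (k \<cdot>\<^sub>v v) = k \<cdot>\<^sub>v (A *\<^sub>v v)"
  using assms by (intro eq_vecI) auto

lemma dual_mult_mat_vec:
  assumes "A \<in> carrier_mat m n" "v \<in> carrier_vec n"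
  shows "map_vec dual_part (A *\<^sub>v v) =
    map_mat std_part A *\<^sub>v map_vec dual_part v + map_mat dual_part A *\<^sub>v map_vec std_part v"
  using assms by (intro eq_vecI) (auto simp: scalar_prod_def sum.distrib)

lemma dcomplex_vec_eqI:
  assumes "dim_vec v = dim_vec w" "map_vec std_part v = map_vec std_part w"
    "map_vec dual_part v = map_vec dual_part w"
  shows "v = w"
proof (rule eq_vecI)
  fix i assume "i < dim_vec w"
  then show "v $ i = w $ i"
    using arg_cong[OF assms(2), of "\<lambda>u. u $ i"] arg_cong[OF assms(3), of "\<lambda>u. u $ i"] assms(1)
    by (simp add: dcomplex_eq_iff)
qed (rule assms(1))

text \<open>Write M for H in the basis \<open>W\<close>, with standard part Ms and dual part Md. The
  vector p + q \<epsilon> is an eigenvector for l + d \<epsilon> iff Ms p = l p and Ms q + Md p = l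
  q + d p. For p = (y, 0) and q = (0, z) the first equation is automatic, and the second reads D y =
  d y in the upper block and R z + C y = l z in the lower one. The latter is solvable for
  \<open>z\<close> because \<open>l\<close> is no eigenvalue of \<open>R\<close>.\<close>

lemma dual_eigenvector:
  assumes H: "H \<in> carrier_mat n n" "adj H = H" and ev: "eigenvalue (map_mat std_part H) l"
  obtains v \<mu> where "v \<in> carrier_vec n" "v \<bullet>c v = 1" "H *\<^sub>v v = \<mu> \<cdot>\<^sub>v v" "std_part \<mu> = l"
proof -
  obtain W k m R where W: "unitary_mat n W" and n: "n = k + m" and R: "R \<in> carrier_mat m m"
    and blk: "map_mat std_part (adj W * H * W) = four_block_mat (l \<cdot>\<^sub>m 1\<^sub>m k) (0\<^sub>m k m) (0\<^sub>m m k) R"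
    and nev: "\<not> eigenvalue R l" and k: "0 < k"
    using eigenspace_block[OF H, of l] ev by blast
  note W' = unitary_matD[OF W]
  define M where "M = adj W * H * W"
  have M: "M \<in> carrier_mat n n" using H W' by (simp add: M_def)
  obtain D B C F where sp: "split_block (map_mat dual_part M) k k = (D, B, C, F)"
    by (metis prod_cases4)
  note dblk = split_block[OF sp, of m m]
  have D: "D \<in> carrier_mat k k" and B: "B \<in> carrier_mat k m" and C: "C \<in> carrier_mat m k"
    and F: "F \<in> carrier_mat m m" and dM: "map_mat dual_part M = four_block_mat D B C F"
    using dblk M n by auto
  \<comment> \<open>\<open>D\<close> has positive size \<open>k\<close> since \<open>l\<close> is an
    eigenvalue of the standard part of \<open>H\<close>.\<close>
  obtain d where "eigenvalue D d"
    using spectrum_non_empty[OF D k] by (auto simp: spectrum_def)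
  then obtain y where y: "y \<in> carrier_vec k" "y \<bullet>c y = 1" "D *\<^sub>v y = d \<cdot>\<^sub>v y"
    using unit_eigenvector_complex[OF D] by blast
  have Cy: "C *\<^sub>v y \<in> carrier_vec m" using C y by simp
  obtain z where z: "z \<in> carrier_vec m" "R *\<^sub>v z + C *\<^sub>v y = l \<cdot>\<^sub>v z"
    using not_eigenvalue_solve[OF R nev Cy] .
  let ?p = "y @\<^sub>v 0\<^sub>v m" and ?q = "0\<^sub>v k @\<^sub>v z"
  define v where "v = vec n (\<lambda>i. DC (?p $ i) (?q $ i))"
  have v: "v \<in> carrier_vec n" "map_vec std_part v = ?p" "map_vec dual_part v = ?q"
    using y z n by (auto simp: v_def)
  \<comment> \<open>The standard part of the square norm is that of \<open>y\<close>; the dual part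
    vanishes because \<open>?p\<close> and \<open>?q\<close> have disjoint supports.\<close>
  have "v \<bullet>c v = 1"
  proof -
    have "std_part (v \<bullet>c v) = ?p \<bullet>c ?p"
      using n y by (simp add: v_def scalar_prod_def)
    also have "\<dots> = (\<Sum>i = 0..<k + m. if i < k then y $ i * cnj (y $ i) else 0)"
      using y by (auto simp: scalar_prod_def intro!: sum.cong)
    also have "\<dots> = (\<Sum>i = 0..<k. y $ i * cnj (y $ i))"
      by (rule sum.mono_neutral_cong_right) auto
    also have "\<dots> = y \<bullet>c y" using y(1) by (simp add: scalar_prod_def)
    finally have "std_part (v \<bullet>c v) = 1" using y(2) by simp
    moreover have "dual_part (v \<bullet>c v) = (\<Sum>i = 0..<k + m. ?p $ i * cnj (?q $ i) + ?q $ i * cnj (?p $ i))"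
      using n by (simp add: v_def scalar_prod_def)
    moreover have "\<dots> = 0"
      using y(1) z(1) by (intro sum.neutral) auto
    ultimately show ?thesis by (simp add: dcomplex_eq_iff)
  qed
  have "M *\<^sub>v v = DC l d \<cdot>\<^sub>v v"
  proof (rule dcomplex_vec_eqI)
    have l1: "l \<cdot>\<^sub>m 1\<^sub>m k \<in> carrier_mat k k" by simp
    have std: "map_mat std_part M = four_block_mat (l \<cdot>\<^sub>m 1\<^sub>m k) (0\<^sub>m k m) (0\<^sub>m m k) R"
      using blk by (simp add: M_def)
    have l1y: "(l \<cdot>\<^sub>m 1\<^sub>m k) *\<^sub>v y = l \<cdot>\<^sub>v y"
      using y by (intro eq_vecI) auto
    have Mp: "map_mat std_part M *\<^sub>v ?p = (l \<cdot>\<^sub>v y) @\<^sub>v 0\<^sub>v m"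
      unfolding std using mult_mat_vec_split[OF l1 R y(1), of "0\<^sub>v m"] R by (simp add: l1y mult_mat_zero_vec[OF R])
    have Mq: "map_mat std_part M *\<^sub>v ?q = 0\<^sub>v k @\<^sub>v (R *\<^sub>v z)"
      unfolding std using mult_mat_vec_split[OF l1 R, of "0\<^sub>v k" z] R z(1) by (simp add: mult_mat_zero_vec[OF l1])
    have dp: "map_mat dual_part M *\<^sub>v ?p = (d \<cdot>\<^sub>v y) @\<^sub>v (C *\<^sub>v y)"
      unfolding dM using four_block_mat_mult_vec[OF D B C F y(1), of "0\<^sub>v m"] B F C y
      by (simp add: mult_mat_zero_vec[OF B] mult_mat_zero_vec[OF F])
    show "map_vec std_part (M *\<^sub>v v) = map_vec std_part (DC l d \<cdot>\<^sub>v v)"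
      unfolding std.mult_mat_vec_hom[OF M v(1)] std.vec_hom_smult v(2) Mp
      using y by (intro eq_vecI) auto
    have "map_vec dual_part (M *\<^sub>v v) = (0\<^sub>v k @\<^sub>v (R *\<^sub>v z)) + ((d \<cdot>\<^sub>v y) @\<^sub>v (C *\<^sub>v y))"
      unfolding dual_mult_mat_vec[OF M v(1)] v(2,3) Mq dp ..
    also have "\<dots> = (d \<cdot>\<^sub>v y) @\<^sub>v (l \<cdot>\<^sub>v z)"
      unfolding z(2)[symmetric] using y(1) z(1) R C by (intro eq_vecI) auto
    also have "\<dots> = map_vec dual_part (DC l d \<cdot>\<^sub>v v)"
      using y z n by (intro eq_vecI) (auto simp: v_def)
    finally show "map_vec dual_part (M *\<^sub>v v) = map_vec dual_part (DC l d \<cdot>\<^sub>v v)" .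
  qed (use M v in simp)
  \<comment> \<open>\<open>W\<close> intertwines \<open>M\<close> and \<open>H\<close>, so it
    carries the eigenvector of \<open>M\<close> to one of \<open>H\<close>.\<close>
  moreover have "W *\<^sub>v (M *\<^sub>v v) = H *\<^sub>v (W *\<^sub>v v)"
  proof -
    have "W * M = H * W"
    proof -
      have "M = adj W * (H * W)"
        unfolding M_def using H W' by (intro assoc_mult_mat) auto
      then show ?thesis
        using unitary_mat_cancel(2)[OF W, of "H * W" n] H W' by simp
    qed
    then show ?thesis
      using assoc_mult_mat_vec[OF W'(1) M v(1)] assoc_mult_mat_vec[OF H(1) W'(1) v(1)] by simp
  qed
  ultimately have "H *\<^sub>v (W *\<^sub>v v) = DC l d \<cdot>\<^sub>v (W *\<^sub>v v)"
    using mult_mat_smult_vec[OF W'(1) v(1), of "DC l d"] by simp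
  moreover have "(W *\<^sub>v v) \<bullet>c (W *\<^sub>v v) = 1"
    using unitary_mult_cscalar_prod[OF W v(1)] \<open>v \<bullet>c v = 1\<close> by simp
  moreover have "W *\<^sub>v v \<in> carrier_vec n" using W' v by simp
  ultimately show ?thesis using that[of "W *\<^sub>v v" "DC l d"] by simp
qed

text \<open>Splitting off the kernel of the standard part leaves a block \<open>R\<close> without
  eigenvalue 0. It is not empty, as otherwise the standard part would be zero. Any eigenvalue of
  \<open>R\<close> is therefore nonzero, and its eigenvector padded with zeros shows that it is an
  eigenvalue of a matrix similar to the standard part of \<open>H\<close>.\<close>

lemma nonzero_eigenvalue:
  assumes H: "H \<in> carrier_mat n n" "adj H = H" and nz: "map_mat std_part H \<noteq> 0\<^sub>m n n"
  obtains l where "eigenvalue (map_mat std_part H) l" "l \<noteq> 0"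
proof -
  obtain W k m R where W: "unitary_mat n W" and n: "n = k + m" and R: "R \<in> carrier_mat m m"
    and blk: "map_mat std_part (adj W * H * W) = four_block_mat (0 \<cdot>\<^sub>m 1\<^sub>m k) (0\<^sub>m k m) (0\<^sub>m m k) R"
    and nev: "\<not> eigenvalue R 0"
    using eigenspace_block[OF H, of 0] by blast
  note W' = unitary_matD[OF W]
  let ?h = "map_mat std_part"
  let ?M = "?h (adj W * H * W)"
  have MH: "?M = ?h (adj W) * ?h H * ?h W"
    using H W' by (simp add: std.mat_hom_mult[of _ n n _ n])
  have "?h (adj W) * ?h W = 1\<^sub>m n" "?h W * ?h (adj W) = 1\<^sub>m n"
    using W' by (simp_all add: std.mat_hom_one flip: std.mat_hom_mult[of _ n n _ n])
  then have wit: "similar_mat_wit ?M (?h H) (?h (adj W)) (?h W)"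
    using MH H W' by (intro similar_mat_witI[of _ _ n]) auto
  have "m \<noteq> 0"
  proof
    assume "m = 0"
    then have M0: "?M = 0\<^sub>m n n"
      unfolding blk using n R by (intro eq_matI) auto
    have "?h H = ?h W * ?M * ?h (adj W)"
      using similar_mat_wit_sym[OF wit] W' by (auto simp: similar_mat_wit_def Let_def)
    then show False
      using nz W' by (simp add: M0)
  qed
  then obtain l where "eigenvalue R l"
    using spectrum_non_empty[OF R] by (auto simp: spectrum_def)
  with nev have l: "l \<noteq> 0" by auto
  obtain z where z: "z \<in> carrier_vec m" "z \<noteq> 0\<^sub>v m" "R *\<^sub>v z = l \<cdot>\<^sub>v z"
    using \<open>eigenvalue R l\<close> R by (auto simp: eigenvalue_def eigenvector_def)
  have M: "?M \<in> carrier_mat n n" using W' H by simp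
  have "?M *\<^sub>v (0\<^sub>v k @\<^sub>v z) = l \<cdot>\<^sub>v (0\<^sub>v k @\<^sub>v z)"
    unfolding blk using mult_mat_vec_split[of "0 \<cdot>\<^sub>m 1\<^sub>m k" k R m "0\<^sub>v k" z] R z
    by (auto intro!: eq_vecI)
  moreover have "0\<^sub>v k @\<^sub>v z \<noteq> 0\<^sub>v n"
  proof
    assume eq: "0\<^sub>v k @\<^sub>v z = 0\<^sub>v n"
    have "z $ i = 0" if "i < m" for i
      using arg_cong[OF eq, of "\<lambda>u. u $ (k + i)"] that z n by simp
    then show False using z(1,2) by (auto intro!: eq_vecI)
  qed
  ultimately have "eigenvalue ?M l"
    using z n M unfolding eigenvalue_def eigenvector_def
    by (intro exI[of _ "0\<^sub>v k @\<^sub>v z"]) (auto simp del: map_carrier_mat)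
  moreover have "char_poly ?M = char_poly (?h H)"
    using wit by (intro char_poly_similar) (auto simp: similar_mat_def)
  ultimately have "eigenvalue (?h H) l"
    using eigenvalue_root_char_poly[OF M] eigenvalue_root_char_poly[of "?h H" n] H by simp
  then show ?thesis using l that by blast
qed

section \<open>Singular value decomposition\<close>

text \<open>Take a dual unit eigenvector \<open>v\<close> of \<open>adj A * A\<close> whose
  eigenvalue \<mu> has nonzero standard part. Then \<mu> is the square norm of
  \<open>A *\<^sub>v v\<close>, so it has a positive appreciable square root \<sigma>, and u is
  \<open>A *\<^sub>v v\<close> divided by \<sigma>.\<close>

lemma singular_pair:
  assumes A: "A \<in> carrier_mat m n" and nz: "map_mat std_part A \<noteq> 0\<^sub>m m n"
  obtains \<sigma> u v where "pos_appreciable \<sigma>" "u \<in> carrier_vec m" "v \<in> carrier_vec n"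
    "u \<bullet>c u = 1" "v \<bullet>c v = 1" "A *\<^sub>v v = \<sigma> \<cdot>\<^sub>v u" "adj A *\<^sub>v u = \<sigma> \<cdot>\<^sub>v v"
proof -
  define H where "H = adj A * A"
  have aA: "adj A \<in> carrier_mat n m" using A by simp
  have H: "H \<in> carrier_mat n n" "adj H = H"
    using A adj_mult[OF aA A] by (auto simp: H_def)
  have "map_mat std_part H \<noteq> 0\<^sub>m n n"
  proof
    assume *: "map_mat std_part H = 0\<^sub>m n n"
    have "std_part (A $$ (i, j)) = 0" if "i < m" "j < n" for i j
    proof -
      let ?c = "vec m (\<lambda>i. std_part (A $$ (i, j)))"
      \<comment> \<open>A diagonal entry of the standard part of \<open>H\<close> is the square norm
        of a column of the standard part of \<open>A\<close>, so all columns would vanish.\<close>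
      have "(map_mat std_part H) $$ (j, j) = (\<Sum>i = 0..<m. cnj (std_part (A $$ (i, j))) * std_part (A $$ (i, j)))"
        using A that by (simp add: H_def scalar_prod_def)
      then have "?c \<bullet>c ?c = 0"
        using * that by (simp add: scalar_prod_def mult.commute)
      then have "?c = 0\<^sub>v m" by (subst (asm) conjugate_square_eq_0_vec[of _ m]) auto
      then show ?thesis using that by (metis index_vec index_zero_vec(1))
    qed
    then have "map_mat std_part A = 0\<^sub>m m n" using A by (intro eq_matI) auto
    with nz show False by simp
  qed
  from nonzero_eigenvalue[OF H this] obtain l where l: "eigenvalue (map_mat std_part H) l" "l \<noteq> 0" .
  from dual_eigenvector[OF H l(1)] obtain v \<mu> where
    v: "v \<in> carrier_vec n" "v \<bullet>c v = 1" "H *\<^sub>v v = \<mu> \<cdot>\<^sub>v v" "std_part \<mu> = l" .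
  define w where "w = A *\<^sub>v v"
  have w: "w \<in> carrier_vec m" using A v by (simp add: w_def)
  have Aw: "adj A *\<^sub>v w = \<mu> \<cdot>\<^sub>v v"
    using v(3) assoc_mult_mat_vec[OF aA A v(1)] by (simp add: H_def w_def)
  \<comment> \<open>Moving \<open>adj A\<close> across the inner product identifies \<mu> as a
    square norm: it is self-conjugate, and its standard part \<open>l\<close> is
    nonnegative.\<close>
  have ww: "w \<bullet>c w = \<mu>"
  proof -
    have "w \<bullet>c w = (adj A *\<^sub>v w) \<bullet>c v"
      using adj_mult_cscalar_prod[OF aA w v(1)] by (simp add: w_def)
    then show ?thesis
      unfolding Aw using v by simp
  qed
  have real: "conjugate \<mu> = \<mu>"
    using w unfolding ww[symmetric]
    by (simp add: scalar_prod_def sum_conjugate conjugate_dist_mul mult.commute)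
  have "l = map_vec std_part w \<bullet>c map_vec std_part w"
    unfolding v(4)[symmetric] ww[symmetric] using w by (simp add: scalar_prod_def)
  also have "\<dots> \<ge> 0" by (rule conjugate_square_ge_0_vec)
  finally have "l \<ge> 0" .
  then obtain a where a: "l = of_real a" "a > 0"
    using l(2) by (intro that[of "Re l"]) (auto simp: less_eq_complex_def complex_eq_iff)
  obtain t where t: "dual_part \<mu> = of_real t"
    using real by (metis Reals_cases Reals_cnj_iff dual_part_simps(7))
  define s where "s = sqrt a"
  have s: "s > 0" "s * s = a" using a by (auto simp: s_def)
  \<comment> \<open>The square root of a + t \<epsilon> to first order: its derivative at
    \<open>a\<close> is 1 / (2 s).\<close>
  define \<sigma> where "\<sigma> = DC (of_real s) (of_real (t / (2 * s)))"
  have \<sigma>: "\<sigma> * \<sigma> = \<mu>"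
  proof -
    have "s * (t / (2 * s)) + t / (2 * s) * s = t" using s by simp
    then have "of_real s * of_real (t / (2 * s)) + of_real (t / (2 * s)) * of_real s = (of_real t :: complex)"
      by (simp only: flip: of_real_mult of_real_add)
    then show ?thesis
      using s a t v(4) by (auto simp: \<sigma>_def dcomplex_eq_iff simp flip: of_real_mult)
  qed
  have app: "pos_appreciable \<sigma>"
    using s by (auto simp: pos_appreciable_def is_dual_number_def \<sigma>_def)
  have c\<sigma>: "conjugate \<sigma> = \<sigma>" by (simp add: dcomplex_eq_iff \<sigma>_def)
  have "std_part \<sigma> \<noteq> 0" using s by (simp add: \<sigma>_def)
  then obtain \<tau> where \<tau>: "\<sigma> * \<tau> = 1" by (rule inverse_dcomplex_ex)
  have c\<tau>: "conjugate \<tau> = \<tau>"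
    using \<tau> c\<sigma> by (metis conjugate_dist_mul conjugate_one_dcomplex mult.assoc mult.commute mult_1)
  define u where "u = \<tau> \<cdot>\<^sub>v w"
  show ?thesis
  proof
    show "pos_appreciable \<sigma>" by (rule app)
    show "u \<in> carrier_vec m" using w by (simp add: u_def)
    show "v \<in> carrier_vec n" "v \<bullet>c v = 1" by (fact v)+
    have "u \<bullet>c u = \<tau> * (\<tau> * \<mu>)"
      using w ww by (simp add: u_def conjugate_smult_vec c\<tau>)
    also have "\<dots> = (\<sigma> * \<tau>) * (\<sigma> * \<tau>)" unfolding \<sigma>[symmetric] by (simp only: mult_ac)
    finally show "u \<bullet>c u = 1" by (simp add: \<tau>)
    show "A *\<^sub>v v = \<sigma> \<cdot>\<^sub>v u"
      by (simp add: u_def smult_smult_assoc \<tau> flip: w_def)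
    have "adj A *\<^sub>v u = (\<tau> * \<mu>) \<cdot>\<^sub>v v"
      using Aw mult_mat_smult_vec[OF aA w] by (simp add: u_def smult_smult_assoc)
    also have "\<tau> * \<mu> = (\<sigma> * \<tau>) * \<sigma>" unfolding \<sigma>[symmetric] by (simp only: mult_ac)
    finally show "adj A *\<^sub>v u = \<sigma> \<cdot>\<^sub>v v" by (simp add: \<tau>)
  qed
qed

section \<open>Assembling the decomposition block by block\<close>

lemma mult_mat_regroup:
  assumes "A \<in> carrier_mat a b" "B \<in> carrier_mat b c" "C \<in> carrier_mat c d"
    "D \<in> carrier_mat d e" "E \<in> carrier_mat e f"
  shows "A * (B * C * D) * E = A * B * C * (D * (E :: 'a :: semiring_1 mat))"
proof -
  have "A * (B * C * D) * E = A * (B * C * D * E)"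
    using assms by (intro assoc_mult_mat) auto
  also have "B * C * D * E = B * C * (D * E)"
    using assms by (intro assoc_mult_mat) auto
  also have "A * (B * C * (D * E)) = A * (B * C) * (D * E)"
    using assms by (intro assoc_mult_mat[symmetric]) auto
  also have "A * (B * C) = A * B * C"
    using assms by (intro assoc_mult_mat[symmetric]) auto
  finally show ?thesis .
qed

text \<open>A decomposition of the lower right block is absorbed into the outer unitary factors.
  This drives the recursion on singular pairs, with \<open>K\<close> of size 1, and later the
  treatment of the infinitesimal block, with \<open>K\<close> the appreciable part.\<close>

lemma border_decomposition:
  assumes U: "unitary_mat (k + m) U" and V: "unitary_mat (k + n) V"
    and W: "unitary_mat m W" and X: "unitary_mat n X"
    and K: "K \<in> carrier_mat k k" and F: "F \<in> carrier_mat m n"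
  shows "U * four_block_mat K (0\<^sub>m k n) (0\<^sub>m m k) (W * F * adj X) * adj V =
    (U * four_block_mat (1\<^sub>m k) (0\<^sub>m k m) (0\<^sub>m m k) W) * four_block_mat K (0\<^sub>m k n) (0\<^sub>m m k) F *
    adj (V * four_block_mat (1\<^sub>m k) (0\<^sub>m k n) (0\<^sub>m n k) X)"
proof -
  note U' = unitary_matD[OF U] and V' = unitary_matD[OF V]
    and W' = unitary_matD[OF W] and X' = unitary_matD[OF X]
  let ?W = "four_block_mat (1\<^sub>m k) (0\<^sub>m k m) (0\<^sub>m m k) W"
  let ?X = "four_block_mat (1\<^sub>m k) (0\<^sub>m k n) (0\<^sub>m n k) X"
  let ?F = "four_block_mat K (0\<^sub>m k n) (0\<^sub>m m k) F"
  note W1 = unitary_matD[OF unitary_mat_border[OF W, of k]]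
  note X1 = unitary_matD[OF unitary_mat_border[OF X, of k]]
  have F1: "?F \<in> carrier_mat (k + m) (k + n)" using K F by simp
  have "four_block_mat K (0\<^sub>m k n) (0\<^sub>m m k) (W * F * adj X) = ?W * ?F * adj ?X"
    using border_mult[OF K zero_carrier_mat zero_carrier_mat F W'(1) X'(2)] W' X'
      adj_four_block_mat[OF one_carrier_mat[of k] zero_carrier_mat[of k n] zero_carrier_mat[of n k] X'(1)]
    by (simp add: left_mult_zero_mat[of _ n n] right_mult_zero_mat[of _ m m] del: assoc_mult_mat)
  then have "U * four_block_mat K (0\<^sub>m k n) (0\<^sub>m m k) (W * F * adj X) * adj V =
      U * ?W * ?F * (adj ?X * adj V)"
    using mult_mat_regroup[OF U'(1) W1(1) F1 X1(2) V'(2)] by simp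
  also have "adj ?X * adj V = adj (V * ?X)"
    using adj_mult[OF V'(1) X1(1)] by simp
  finally show ?thesis .
qed

lemma pos_appreciable_conjugate: "pos_appreciable \<sigma> \<Longrightarrow> conjugate \<sigma> = \<sigma>"
  by (simp add: pos_appreciable_def is_dual_number_def dcomplex_eq_iff Reals_cnj_iff)

text \<open>Induction on the number of rows: while the standard part is nonzero, a singular pair is
  split off. The block \<open>S\<close> left at the end is infinitesimal but not yet
  diagonal.\<close>

lemma appreciable_svd:
  assumes "A \<in> carrier_mat m n"
  shows "\<exists>U V r k l \<mu> S. m = r + k \<and> n = r + l \<and> unitary_mat m U \<and> unitary_mat n V \<and>
    (\<forall>i<r. pos_appreciable (\<mu> i)) \<and> S \<in> carrier_mat k l \<and> map_mat std_part S = 0\<^sub>m k l \<and>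
    A = U * four_block_mat (mat_diag r \<mu>) (0\<^sub>m r l) (0\<^sub>m k r) S * adj V"
  using assms
proof (induction m arbitrary: n A)
  \<comment> \<open>A matrix with zero standard part is its own remainder, with
    \<open>r = 0\<close>. This covers both the empty matrix and the end of the deflation.\<close>
  have base: "\<exists>U V r k l \<mu> S. m = r + k \<and> n = r + l \<and> unitary_mat m U \<and> unitary_mat n V \<and>
    (\<forall>i<r. pos_appreciable (\<mu> i)) \<and> S \<in> carrier_mat k l \<and> map_mat std_part S = 0\<^sub>m k l \<and>
    A = U * four_block_mat (mat_diag r \<mu>) (0\<^sub>m r l) (0\<^sub>m k r) S * adj V"
    if A: "A \<in> carrier_mat m n" and A0: "map_mat std_part A = 0\<^sub>m m n" for A m n
  proof -
    have "four_block_mat (mat_diag 0 \<mu>) (0\<^sub>m 0 n) (0\<^sub>m m 0) A = A" for \<mu>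
      using A by (intro eq_matI) auto
    then have eq: "A = 1\<^sub>m m * four_block_mat (mat_diag 0 \<mu>) (0\<^sub>m 0 n) (0\<^sub>m m 0) A * adj (1\<^sub>m n)" for \<mu>
      using A by simp
    show ?thesis
    proof (intro exI conjI)
      show "A = 1\<^sub>m m * four_block_mat (mat_diag 0 (\<lambda>_. 0)) (0\<^sub>m 0 n) (0\<^sub>m m 0) A * adj (1\<^sub>m n)"
        by (rule eq)
    qed (use A A0 unitary_mat_one in auto)
  qed
  {
    case 0
    have "map_mat std_part A = 0\<^sub>m 0 n" using 0 by (intro eq_matI) auto
    with 0 show ?case by (rule base)
  next
    case (Suc m)
    let ?m = "Suc m"
    show ?case
    proof (cases "map_mat std_part A = 0\<^sub>m ?m n")
      case True
      with Suc.prems show ?thesis by (rule base)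
    next
      case False
      note A = Suc.prems
      have "n \<noteq> 0"
      proof
        assume "n = 0"
        then have "map_mat std_part A = 0\<^sub>m ?m n" using A by (intro eq_matI) auto
        with False show False by simp
      qed
      then obtain n' where n: "n = Suc n'" using not0_implies_Suc by blast
      obtain \<sigma> u v where \<sigma>: "pos_appreciable \<sigma>" and u: "u \<in> carrier_vec ?m" "u \<bullet>c u = 1"
        and v: "v \<in> carrier_vec n" "v \<bullet>c v = 1"
        and Av: "A *\<^sub>v v = \<sigma> \<cdot>\<^sub>v u" and Au: "adj A *\<^sub>v u = \<sigma> \<cdot>\<^sub>v v"
        using singular_pair[OF A False] .
      obtain U where U: "unitary_mat ?m U" "U *\<^sub>v unit_vec ?m 0 = u"
        using unitary_completion[OF u] by auto
      obtain V where V: "unitary_mat n V" "V *\<^sub>v unit_vec n 0 = v"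
        using unitary_completion[OF v] n by auto
      note U' = unitary_matD[OF U(1)] and V' = unitary_matD[OF V(1)]
      define M where "M = adj U * A * V"
      have M: "M \<in> carrier_mat ?m n" using U' V' A by (simp add: M_def)
      have aA: "adj A \<in> carrier_mat n ?m" using A by simp
      have aM: "adj M = adj V * (adj A * U)"
      proof -
        have "adj M = adj V * adj (adj U * A)"
          unfolding M_def using U' V' A by (intro adj_mult) auto
        then show ?thesis
          using adj_mult[OF U'(2) A] by simp
      qed
      have em: "unit_vec ?m 0 \<in> carrier_vec ?m" and en: "unit_vec n 0 \<in> carrier_vec n" by auto
      have "M *\<^sub>v unit_vec n 0 = adj U *\<^sub>v (A *\<^sub>v v)"
        unfolding M_def V(2)[symmetric] using U' V' A en
        by (simp add: assoc_mult_mat_vec[of _ ?m n _ n] assoc_mult_mat_vec[of _ ?m ?m _ n])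
      also have "\<dots> = \<sigma> \<cdot>\<^sub>v (adj U *\<^sub>v u)"
        unfolding Av using mult_mat_smult_vec[OF U'(2) u(1)] .
      also have "adj U *\<^sub>v u = unit_vec ?m 0"
        unfolding U(2)[symmetric] assoc_mult_mat_vec[OF U'(2,1) em, symmetric] U'(3) by simp
      finally have Me: "M *\<^sub>v unit_vec n 0 = \<sigma> \<cdot>\<^sub>v unit_vec ?m 0" .
      have "adj M *\<^sub>v unit_vec ?m 0 = adj V *\<^sub>v (adj A *\<^sub>v u)"
        unfolding aM U(2)[symmetric] using U' V' aA em
        by (simp add: assoc_mult_mat_vec[of _ n ?m _ ?m] assoc_mult_mat_vec[of _ n n _ ?m])
      also have "\<dots> = \<sigma> \<cdot>\<^sub>v (adj V *\<^sub>v v)"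
        unfolding Au using mult_mat_smult_vec[OF V'(2) v(1)] .
      also have "adj V *\<^sub>v v = unit_vec n 0"
        unfolding V(2)[symmetric] assoc_mult_mat_vec[OF V'(2,1) en, symmetric] V'(3) by simp
      finally have aMe: "adj M *\<^sub>v unit_vec ?m 0 = \<sigma> \<cdot>\<^sub>v unit_vec n 0" .
      have col: "M $$ (i, 0) = (if i = 0 then \<sigma> else 0)" if "i < ?m" for i
        using arg_cong[OF Me, of "\<lambda>u. u $ i"] that M n by (auto split: if_splits)
      \<comment> \<open>Column 0 came from the equation for \<open>A\<close>; row 0 comes from the
        one for \<open>adj A\<close>, and \<sigma> is self-conjugate.\<close>
      have row: "M $$ (0, j) = (if j = 0 then \<sigma> else 0)" if "j < n" for j
      proof -
        have "conjugate (M $$ (0, j)) = (if j = 0 then \<sigma> else 0)"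
          using arg_cong[OF aMe, of "\<lambda>u. u $ j"] that M by (auto split: if_splits)
        then have "M $$ (0, j) = conjugate (if j = 0 then \<sigma> else 0)"
          by (metis conjugate_id)
        then show ?thesis using pos_appreciable_conjugate[OF \<sigma>] by auto
      qed
      define D where "D = mat m n' (\<lambda>(i, j). M $$ (Suc i, Suc j))"
      have D: "D \<in> carrier_mat m n'" by (simp add: D_def)
      have Mblk: "M = four_block_mat (mat_diag 1 (\<lambda>_. \<sigma>)) (0\<^sub>m 1 n') (0\<^sub>m m 1) D"
        (is "_ = ?R")
      proof (rule eq_matI)
        fix i j assume "i < dim_row ?R" "j < dim_col ?R"
        then show "M $$ (i, j) = ?R $$ (i, j)"
          using col[of i] row[of j] n by (cases i; cases j) (auto simp: D_def mat_diag_def)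
      qed (use M D n in auto)
      have "A = U * M * adj V"
      proof -
        have "U * M = U * (adj U * (A * V))"
          unfolding M_def using U' V' A by simp
        also have "\<dots> = A * V"
          using unitary_mat_cancel(2)[OF U(1), of "A * V" n] A V' by simp
        also have "A * V * adj V = A * (V * adj V)"
          using A V' by (intro assoc_mult_mat) auto
        finally show ?thesis using A V' by simp
      qed
      obtain W X r k l \<mu> S where m: "m = r + k" and n': "n' = r + l"
        and W: "unitary_mat m W" and X: "unitary_mat n' X"
        and \<mu>: "\<forall>i<r. pos_appreciable (\<mu> i)" and S: "S \<in> carrier_mat k l" "map_mat std_part S = 0\<^sub>m k l"
        and DS: "D = W * four_block_mat (mat_diag r \<mu>) (0\<^sub>m r l) (0\<^sub>m k r) S * adj X"
        using Suc.IH[OF D] by blast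
      let ?F = "four_block_mat (mat_diag r \<mu>) (0\<^sub>m r l) (0\<^sub>m k r) S"
      let ?W = "four_block_mat (1\<^sub>m 1) (0\<^sub>m 1 m) (0\<^sub>m m 1) W"
      let ?X = "four_block_mat (1\<^sub>m 1) (0\<^sub>m 1 n') (0\<^sub>m n' 1) X"
      \<comment> \<open>\<open>case_nat \<sigma> \<mu>\<close> puts \<sigma> in front of the
        singular values of \<open>D\<close> and shifts their indices by one.\<close>
      let ?G = "four_block_mat (mat_diag (Suc r) (case_nat \<sigma> \<mu>)) (0\<^sub>m (Suc r) l) (0\<^sub>m k (Suc r)) S"
      have F: "?F \<in> carrier_mat m n'" using S m n' by simp
      have "A = (U * ?W) * four_block_mat (mat_diag 1 (\<lambda>_. \<sigma>)) (0\<^sub>m 1 n') (0\<^sub>m m 1) ?F * adj (V * ?X)"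
        unfolding \<open>A = U * M * adj V\<close> Mblk DS
        using U(1) V(1) W X F n by (intro border_decomposition) auto
      also have "four_block_mat (mat_diag 1 (\<lambda>_. \<sigma>)) (0\<^sub>m 1 n') (0\<^sub>m m 1) ?F = ?G" (is "?L = _")
      proof (rule eq_matI)
        fix i j assume "i < dim_row ?G" "j < dim_col ?G"
        then show "?L $$ (i, j) = ?G $$ (i, j)"
          using S m n' by (cases i; cases j) (auto simp: mat_diag_def)
      qed (use S m n' in auto)
      finally have A_eq: "A = (U * ?W) * ?G * adj (V * ?X)" .
      show ?thesis
      proof (intro exI conjI)
        show "A = (U * ?W) * ?G * adj (V * ?X)" by (rule A_eq)
        show "unitary_mat ?m (U * ?W)"
          using unitary_mat_mult[OF U(1)] unitary_mat_border[OF W, of 1] by auto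
        show "unitary_mat n (V * ?X)"
          using unitary_mat_mult[OF V(1)] unitary_mat_border[OF X, of 1] n by auto
        show "\<forall>i<Suc r. pos_appreciable (case_nat \<sigma> \<mu> i)"
          using \<sigma> \<mu> by (auto split: nat.split)
      qed (use m n n' S in auto)
    qed
  }
qed

lemma block_diag_mult:
  fixes A1 :: "'a :: semiring_1 mat"
  assumes "A1 \<in> carrier_mat r r" "A2 \<in> carrier_mat r r" "D1 \<in> carrier_mat a b" "D2 \<in> carrier_mat b c"
  shows "four_block_mat A1 (0\<^sub>m r b) (0\<^sub>m a r) D1 * four_block_mat A2 (0\<^sub>m r c) (0\<^sub>m b r) D2 =
    four_block_mat (A1 * A2) (0\<^sub>m r c) (0\<^sub>m a r) (D1 * D2)"
  using assms mult_four_block_mat[OF assms(1) zero_carrier_mat zero_carrier_mat assms(3)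
      assms(2) zero_carrier_mat zero_carrier_mat assms(4)]
  by simp

text \<open>The infinitesimal remainder is \<open>eps \<cdot>\<^sub>m C\<close>, and
  \<open>C\<close> is decomposed in the same way. Multiplication by \<open>eps\<close> turns the
  appreciable values of \<open>C\<close> into positive infinitesimal ones and annihilates the
  infinitesimal remainder of \<open>C\<close>, so nothing off the diagonal survives.\<close>

lemma svd_exists:
  assumes A: "A \<in> carrier_mat m n"
  shows "\<exists>U r \<mu> S V. is_svd A U r \<mu> S V"
proof -
  obtain U V r k l \<mu> S where m: "m = r + k" and n: "n = r + l"
    and U: "unitary_mat m U" and V: "unitary_mat n V" and \<mu>: "\<forall>i<r. pos_appreciable (\<mu> i)"
    and S: "S \<in> carrier_mat k l" and S0: "map_mat std_part S = 0\<^sub>m k l"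
    and AS: "A = U * four_block_mat (mat_diag r \<mu>) (0\<^sub>m r l) (0\<^sub>m k r) S * adj V"
    using appreciable_svd[OF A] by blast
  \<comment> \<open>The dual part of \<open>S\<close> is promoted to a standard part; the zero dual
    part is a free choice, since \<open>eps\<close> would annihilate it.\<close>
  define C where "C = map_mat (\<lambda>x. DC (dual_part x) 0) S"
  have C: "C \<in> carrier_mat k l" using S by (simp add: C_def)
  have SC: "S = eps \<cdot>\<^sub>m C"
  proof (rule eq_matI)
    fix i j assume "i < dim_row (eps \<cdot>\<^sub>m C)" "j < dim_col (eps \<cdot>\<^sub>m C)"
    then have ij: "i < k" "j < l" using C by auto
    then have "std_part (S $$ (i, j)) = 0"
      using arg_cong[OF S0, of "\<lambda>M. M $$ (i, j)"] S by simp
    then show "S $$ (i, j) = (eps \<cdot>\<^sub>m C) $$ (i, j)"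
      using ij S by (simp add: C_def eps_def dcomplex_eq_iff)
  qed (use S C in auto)
  obtain W X r' k' l' \<nu> T where k: "k = r' + k'" and l: "l = r' + l'"
    and W: "unitary_mat k W" and X: "unitary_mat l X" and \<nu>: "\<forall>i<r'. pos_appreciable (\<nu> i)"
    and T: "T \<in> carrier_mat k' l'" and T0: "map_mat std_part T = 0\<^sub>m k' l'"
    and CT: "C = W * four_block_mat (mat_diag r' \<nu>) (0\<^sub>m r' l') (0\<^sub>m k' r') T * adj X"
    using appreciable_svd[OF C] by blast
  note W' = unitary_matD[OF W] and X' = unitary_matD[OF X]
  define G where "G = four_block_mat (mat_diag r' \<nu>) (0\<^sub>m r' l') (0\<^sub>m k' r') T"
  have G: "G \<in> carrier_mat k l" using T k l by (simp add: G_def)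
  have SG: "S = W * (eps \<cdot>\<^sub>m G) * adj X"
  proof -
    have "W * (eps \<cdot>\<^sub>m G) * adj X = eps \<cdot>\<^sub>m (W * G) * adj X"
      using mult_smult_distrib[OF W'(1) G] by simp
    also have "\<dots> = eps \<cdot>\<^sub>m (W * G * adj X)"
      using mult_smult_assoc_mat[OF mult_carrier_mat[OF W'(1) G] X'(2)] .
    finally show ?thesis unfolding SC CT G_def ..
  qed
  have Gij: "(eps \<cdot>\<^sub>m G) $$ (i, j) = (if i = j \<and> i < r' then eps * \<nu> i else 0)"
    if ij: "i < k" "j < l" for i j
  proof -
    have "eps * T $$ (a, b) = 0" if "a < k'" "b < l'" for a b
      using arg_cong[OF T0, of "\<lambda>M. M $$ (a, b)"] that T by (simp add: dcomplex_eq_iff eps_def)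
    then show ?thesis
      using ij T k l by (auto simp: G_def mat_diag_def)
  qed
  let ?W = "four_block_mat (1\<^sub>m r) (0\<^sub>m r k) (0\<^sub>m k r) W"
  let ?X = "four_block_mat (1\<^sub>m r) (0\<^sub>m r l) (0\<^sub>m l r) X"
  have eG: "eps \<cdot>\<^sub>m G \<in> carrier_mat k l" using G by simp
  have "A = (U * ?W) * four_block_mat (mat_diag r \<mu>) (0\<^sub>m r l) (0\<^sub>m k r) (eps \<cdot>\<^sub>m G) * adj (V * ?X)"
    unfolding AS SG using U V m n by (intro border_decomposition[OF _ _ W X _ eG]) auto
  moreover have "unitary_mat m (U * ?W)" "unitary_mat n (V * ?X)"
    using unitary_mat_mult[OF U] unitary_mat_mult[OF V]
      unitary_mat_border[OF W, of r] unitary_mat_border[OF X, of r] m n by auto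
  moreover have "pos_infinitesimal (eps * \<nu> i)" if "i < r'" for i
    using \<nu> that by (auto simp: pos_infinitesimal_def pos_appreciable_def is_dual_number_def eps_def)
  then have "\<forall>i < min k l. pos_infinitesimal ((eps \<cdot>\<^sub>m G) $$ (i, i)) \<or> (eps \<cdot>\<^sub>m G) $$ (i, i) = 0"
    using Gij by auto
  moreover have "diagonal_mat (eps \<cdot>\<^sub>m G)"
    unfolding diagonal_mat_def using Gij G by auto
  ultimately have "is_svd A (U * ?W) r \<mu> (eps \<cdot>\<^sub>m G) (V * ?X)"
    unfolding is_svd_def Let_def using A \<mu> eG m n by (metis add_diff_cancel_left' carrier_matD le_add1)
  then show ?thesis by blast
qed

section \<open>Weak inverses\<close>

text \<open>The defining equations of the inverse, with the condition on \<open>A X A\<close> required for standard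
  parts only. This avoids the essential part, and is inherited by products.\<close>

definition weak_ndmpi :: "dcomplex mat \<Rightarrow> dcomplex mat \<Rightarrow> bool" where
  "weak_ndmpi A X \<longleftrightarrow>
    X \<in> carrier_mat (dim_col A) (dim_row A) \<and>
    map_mat std_part (A * X * A) = map_mat std_part A \<and>
    X * A * X = X \<and>
    adj (A * X) = A * X \<and>
    adj (X * A) = X * A"

section \<open>Uniqueness of weak inverses\<close>

lemma std_part_adj_cong:
  assumes "map_mat std_part A = map_mat std_part B"
  shows "map_mat std_part (adj A) = map_mat std_part (adj B)"
proof -
  have dim: "dim_row A = dim_row B" "dim_col A = dim_col B"
    using arg_cong[OF assms, of dim_row] arg_cong[OF assms, of dim_col] by auto
  show ?thesis
  proof (rule eq_matI)
    fix i j
    assume "i < dim_row (map_mat std_part (adj B))" "j < dim_col (map_mat std_part (adj B))"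
    then show "map_mat std_part (adj A) $$ (i, j) = map_mat std_part (adj B) $$ (i, j)"
      using arg_cong[OF assms, of "\<lambda>M. M $$ (j, i)"] dim by simp
  qed (simp_all add: dim)
qed

text \<open>This expands \<open>(A - A') * (B - B') = 0\<close>, a product of two infinitesimal matrices.\<close>

lemma infinitesimal_mult:
  fixes A A' B B' :: "dcomplex mat"
  assumes c: "A \<in> carrier_mat m k" "A' \<in> carrier_mat m k" "B \<in> carrier_mat k n" "B' \<in> carrier_mat k n"
    and A: "map_mat std_part A = map_mat std_part A'"
    and B: "map_mat std_part B = map_mat std_part B'"
  shows "A * B + A' * B' = A * B' + A' * B"
proof (rule eq_matI)
  fix i j assume "i < dim_row (A * B' + A' * B)" "j < dim_col (A * B' + A' * B)"
  then have ij: "i < m" "j < n" using c by auto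
  have "A $$ (i, l) * B $$ (l, j) + A' $$ (i, l) * B' $$ (l, j) =
      A $$ (i, l) * B' $$ (l, j) + A' $$ (i, l) * B $$ (l, j)" if l: "l < k" for l
  proof -
    have "std_part (A $$ (i, l)) = std_part (A' $$ (i, l))"
      using arg_cong[OF A, of "\<lambda>M. M $$ (i, l)"] l ij c by simp
    moreover have "std_part (B $$ (l, j)) = std_part (B' $$ (l, j))"
      using arg_cong[OF B, of "\<lambda>M. M $$ (l, j)"] l ij c by simp
    ultimately show ?thesis by (simp add: dcomplex_eq_iff algebra_simps)
  qed
  then have "(\<Sum>l = 0..<k. A $$ (i, l) * B $$ (l, j)) + (\<Sum>l = 0..<k. A' $$ (i, l) * B' $$ (l, j)) =
      (\<Sum>l = 0..<k. A $$ (i, l) * B' $$ (l, j)) + (\<Sum>l = 0..<k. A' $$ (i, l) * B $$ (l, j))"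
    unfolding sum.distrib[symmetric] by (intro sum.cong) auto
  then show "(A * B + A' * B') $$ (i, j) = (A * B' + A' * B) $$ (i, j)"
    using c ij by (simp add: scalar_prod_def)
qed (use c in auto)

lemma add_right_cancel_mat:
  fixes A B C :: "'a :: group_add mat"
  assumes "A \<in> carrier_mat m n" "B \<in> carrier_mat m n" "C \<in> carrier_mat m n" "A + C = B + C"
  shows "A = B"
proof (rule eq_matI)
  fix i j assume "i < dim_row B" "j < dim_col B"
  then show "A $$ (i, j) = B $$ (i, j)"
    using arg_cong[OF assms(4), of "\<lambda>M. M $$ (i, j)"] assms(1-3) by simp
qed (use assms in auto)

text \<open>In standard parts, A X A Y = A Y and, with the roles exchanged, A Y A X = A X. The
  adjoint of the first equation is A Y A X = A Y, hence A X = A Y. The argument for X A and Y A is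
  symmetric.\<close>

lemma weak_ndmpi_projections:
  assumes A: "A \<in> carrier_mat m n" and X: "weak_ndmpi A X" and Y: "weak_ndmpi A Y"
  shows "map_mat std_part (A * X) = map_mat std_part (A * Y)"
    and "map_mat std_part (X * A) = map_mat std_part (Y * A)"
proof -
  let ?h = "map_mat std_part"
  have h: "?h (P * Q * R * Z) = ?h (P * Q * R) * ?h Z" "?h (P * (Q * R * Z)) = ?h P * ?h (Q * R * Z)"
    if "P \<in> carrier_mat a b" "Q \<in> carrier_mat b c" "R \<in> carrier_mat c d" "Z \<in> carrier_mat d e"
    for P Q R Z a b c d e
  proof -
    show "?h (P * Q * R * Z) = ?h (P * Q * R) * ?h Z"
      by (rule std.mat_hom_mult[of _ a d _ e]) (use that in auto)
    show "?h (P * (Q * R * Z)) = ?h P * ?h (Q * R * Z)"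
      by (rule std.mat_hom_mult[of _ a b _ e]) (use that in auto)
  qed
  have left: "?h (A * X * (A * Y)) = ?h (A * Y)"
    and right: "?h (Y * A * (X * A)) = ?h (Y * A)"
    if "weak_ndmpi A X" "Y \<in> carrier_mat n m" for X Y
  proof -
    have c: "X \<in> carrier_mat n m" and e: "?h (A * X * A) = ?h A"
      using that A by (auto simp: weak_ndmpi_def)
    have "A * X * (A * Y) = A * X * A * Y"
      using A c that(2) by (intro assoc_mult_mat[symmetric]) auto
    then show "?h (A * X * (A * Y)) = ?h (A * Y)"
      using h(1)[OF A c A that(2)] e std.mat_hom_mult[OF A that(2)] by simp
    have "Y * A * (X * A) = Y * (A * (X * A))"
      using A c that(2) by (intro assoc_mult_mat) auto
    also have "A * (X * A) = A * X * A"
      using A c by (intro assoc_mult_mat[symmetric]) auto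
    finally show "?h (Y * A * (X * A)) = ?h (Y * A)"
      using h(2)[OF that(2) A c A] e std.mat_hom_mult[OF that(2) A] by simp
  qed
  have c: "X \<in> carrier_mat n m" "Y \<in> carrier_mat n m"
    and aX: "adj (A * X) = A * X" "adj (X * A) = X * A"
    and aY: "adj (A * Y) = A * Y" "adj (Y * A) = Y * A"
    using X Y A by (auto simp: weak_ndmpi_def)
  have "?h (A * Y * (A * X)) = ?h (adj (A * X * (A * Y)))"
    using adj_mult[of "A * X" m m "A * Y" m] aX aY A c by simp
  also have "\<dots> = ?h (adj (A * Y))"
    by (rule std_part_adj_cong) (rule left[OF X c(2)])
  finally show "?h (A * X) = ?h (A * Y)"
    using left[OF Y c(1)] aY by simp
  have "?h (X * A * (Y * A)) = ?h (adj (Y * A * (X * A)))"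
    using adj_mult[of "Y * A" n n "X * A" n] aX aY A c by simp
  also have "\<dots> = ?h (adj (Y * A))"
    by (rule std_part_adj_cong) (rule right[OF X c(2)])
  finally show "?h (X * A) = ?h (Y * A)"
    using right[OF Y c(1)] aY by simp
qed

text \<open>The products of \<open>p' - p\<close> and \<open>A - E\<close>, of \<open>A - E\<close>
  and \<open>q' - q\<close>, and of \<open>p' * E - p * E\<close> and \<open>q' - q\<close> vanish,
  all factors being infinitesimal. The first gives \<open>p' * E = F\<close>, the second
  \<open>E * q' = F\<close>, and with these the third collapses to
  \<open>E + F = F + F\<close>.\<close>

lemma weak_ndmpi_essential_unique:
  assumes A: "A \<in> carrier_mat m n" and X: "weak_ndmpi A X" and Y: "weak_ndmpi A Y"
  shows "A * X * A = A * Y * A"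
proof -
  define E F where "E = A * X * A" and "F = A * Y * A"
  define p p' q q' where "p = A * X" and "p' = A * Y" and "q = X * A" and "q' = Y * A"
  have cX: "X \<in> carrier_mat n m" "X * A * X = X" "map_mat std_part E = map_mat std_part A"
    using X A by (auto simp: weak_ndmpi_def E_def)
  have cY: "Y \<in> carrier_mat n m" "Y * A * Y = Y" "map_mat std_part F = map_mat std_part A"
    using Y A by (auto simp: weak_ndmpi_def F_def)
  have c: "p \<in> carrier_mat m m" "p' \<in> carrier_mat m m" "q \<in> carrier_mat n n" "q' \<in> carrier_mat n n"
    "E \<in> carrier_mat m n" "F \<in> carrier_mat m n"
    using A cX(1) cY(1) by (auto simp: p_def p'_def q_def q'_def E_def F_def)
  have hp: "map_mat std_part p' = map_mat std_part p" and hq: "map_mat std_part q' = map_mat std_part q"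
    using weak_ndmpi_projections[OF A Y X] by (simp_all add: p_def p'_def q_def q'_def)
  note dims = carrier_matD[OF A] carrier_matD[OF cX(1)] carrier_matD[OF cY(1)] index_mult_mat(2,3)
  have "A * (X * A * X) * A = A * X * A" unfolding cX(2) ..
  then have E1: "p * A = E" "A * q = E" "p * E = E" "E * q = E"
    unfolding p_def q_def E_def by (simp_all only: assoc_mult_mat_dim dims)
  have "A * (Y * A * Y) * A = A * Y * A" unfolding cY(2) ..
  then have F1: "p' * A = F" "A * q' = F" "p' * F = F" "F * q' = F"
    unfolding p'_def q'_def F_def by (simp_all only: assoc_mult_mat_dim dims)
  have "p' * A + p * E = p' * E + p * A"
    by (rule infinitesimal_mult[OF c(2,1) A c(5) hp cX(3)[symmetric]])
  then have 1: "F + E = p' * E + E"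
    unfolding E1 F1 .
  have pE: "p' * E = F"
    by (rule add_right_cancel_mat[OF c(6) mult_carrier_mat[OF c(2,5)] c(5) 1, symmetric])
  have "A * q' + E * q = A * q + E * q'"
    by (rule infinitesimal_mult[OF A c(5,4,3) cX(3)[symmetric] hq])
  then have 2: "F + E = E * q' + E"
    unfolding E1 F1 comm_add_mat[OF c(5) mult_carrier_mat[OF c(5,4)]] .
  have Eq: "E * q' = F"
    by (rule add_right_cancel_mat[OF c(6) mult_carrier_mat[OF c(5,4)] c(5) 2, symmetric])
  have "p' * E * q' + p * E * q = p' * E * q + p * E * q'"
  proof (rule infinitesimal_mult[OF mult_carrier_mat[OF c(2,5)] mult_carrier_mat[OF c(1,5)] c(4,3) _ hq])
    show "map_mat std_part (p' * E) = map_mat std_part (p * E)"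
      unfolding E1 pE cX(3) cY(3) ..
  qed
  moreover have "p' * E * q = F"
    by (subst assoc_mult_mat[OF c(2,5,3)]) (simp only: E1 pE)
  ultimately have "E + F = F + F"
    unfolding pE E1 F1 Eq comm_add_mat[OF c(6,5)] by simp
  then have "E = F"
    by (rule add_right_cancel_mat[OF c(5,6,6)])
  then show ?thesis by (simp add: E_def F_def)
qed

text \<open>With A X A = A Y A at hand, Penrose's argument applies: A X = A X A X = A Y A X, whose
  adjoint is A X A Y = A Y A Y = A Y. Similarly X A = Y A, and then X = Y A X = Y A Y = Y.\<close>

lemma weak_ndmpi_unique:
  assumes A: "A \<in> carrier_mat m n" and X: "weak_ndmpi A X" and Y: "weak_ndmpi A Y"
  shows "X = Y"
proof -
  have cX: "X \<in> carrier_mat n m" "X * A * X = X" "adj (A * X) = A * X" "adj (X * A) = X * A"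
    using X A by (auto simp: weak_ndmpi_def)
  have cY: "Y \<in> carrier_mat n m" "Y * A * Y = Y" "adj (A * Y) = A * Y" "adj (Y * A) = Y * A"
    using Y A by (auto simp: weak_ndmpi_def)
  note E = weak_ndmpi_essential_unique[OF A X Y]
  note dims = carrier_matD[OF A] carrier_matD[OF cX(1)] carrier_matD[OF cY(1)] index_mult_mat(2,3)
  have "A * X = A * X * A * X"
    using arg_cong[OF cX(2), of "\<lambda>M. A * M"] by (simp only: assoc_mult_mat_dim dims)
  also have "\<dots> = A * Y * A * X" unfolding E ..
  also have "\<dots> = (A * Y) * (A * X)" by (simp only: assoc_mult_mat_dim dims)
  finally have "adj (A * X) = adj ((A * Y) * (A * X))" by simp
  also have "\<dots> = (A * X) * (A * Y)"
    using adj_mult[of "A * Y" m m "A * X" m] A cX cY by simp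
  also have "\<dots> = A * X * A * Y" by (simp only: assoc_mult_mat_dim dims)
  also have "\<dots> = A * (Y * A * Y)" unfolding E by (simp only: assoc_mult_mat_dim dims)
  finally have AX: "A * X = A * Y" using cX cY by simp
  have "X * A = X * A * X * A" unfolding cX(2) ..
  also have "\<dots> = X * (A * X * A)" by (simp only: assoc_mult_mat_dim dims)
  also have "\<dots> = (X * A) * (Y * A)" unfolding E by (simp only: assoc_mult_mat_dim dims)
  finally have "adj (X * A) = adj ((X * A) * (Y * A))" by simp
  also have "\<dots> = (Y * A) * (X * A)"
    using adj_mult[of "X * A" n n "Y * A" n] A cX cY by simp
  also have "\<dots> = Y * (A * X * A)" by (simp only: assoc_mult_mat_dim dims)
  also have "\<dots> = Y * A * Y * A" unfolding E by (simp only: assoc_mult_mat_dim dims)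
  finally have XA: "X * A = Y * A" using cX cY by simp
  have "X = Y * A * X" using cX(2) XA by simp
  also have "\<dots> = Y * (A * X)" by (simp only: assoc_mult_mat_dim dims)
  also have "\<dots> = Y * A * Y" unfolding AX by (simp only: assoc_mult_mat_dim dims)
  finally show ?thesis using cY by simp
qed

text \<open>The witness inverts the appreciable block and is zero elsewhere. Then A X and X A are
  unitary conjugates of \<open>J k\<close> and \<open>J l\<close>, hence Hermitian, and A X A loses
  exactly the infinitesimal block \<open>S\<close>. The second conclusion ties A X A to the
  essential part read off from this decomposition.\<close>

lemma svd_weak_ndmpi:
  assumes svd: "is_svd A U r \<mu> S V" and A: "A \<in> carrier_mat m n"
  obtains X where "weak_ndmpi A X"
    "A * X * A = U * four_block_mat (mat_diag r \<mu>) (0\<^sub>m r (n - r)) (0\<^sub>m (m - r) r) (0\<^sub>m (m - r) (n - r)) * adj V"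
proof -
  define k l where "k = m - r" and "l = n - r"
  have U: "unitary_mat m U" and V: "unitary_mat n V" and m: "m = r + k" and n: "n = r + l"
    and \<mu>: "\<forall>i<r. pos_appreciable (\<mu> i)" and S: "S \<in> carrier_mat k l" and diag: "diagonal_mat S"
    and inf: "\<forall>i < min k l. pos_infinitesimal (S $$ (i, i)) \<or> S $$ (i, i) = 0"
    and AS: "A = U * four_block_mat (mat_diag r \<mu>) (0\<^sub>m r l) (0\<^sub>m k r) S * adj V"
    using svd A by (auto simp: is_svd_def Let_def k_def l_def)
  note U' = unitary_matD[OF U] and V' = unitary_matD[OF V]
  have "\<exists>t. \<mu> i * t = 1" if "i < r" for i
    using \<mu> that inverse_dcomplex_ex[of "\<mu> i"] by (fastforce simp: pos_appreciable_def)
  then obtain \<tau> where \<tau>: "\<And>i. i < r \<Longrightarrow> \<mu> i * \<tau> i = 1" by metis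
  define G where "G = four_block_mat (mat_diag r \<mu>) (0\<^sub>m r l) (0\<^sub>m k r) S"
  define G0 where "G0 = four_block_mat (mat_diag r \<mu>) (0\<^sub>m r l) (0\<^sub>m k r) (0\<^sub>m k l)"
  define Y where "Y = four_block_mat (mat_diag r \<tau>) (0\<^sub>m r k) (0\<^sub>m l r) (0\<^sub>m l k)"
  define J where "J k = four_block_mat (1\<^sub>m r) (0\<^sub>m r k) (0\<^sub>m k r) (0\<^sub>m k k :: dcomplex mat)" for k
  have d1: "mat_diag r (\<lambda>i. \<mu> i * \<tau> i) = 1\<^sub>m r" "mat_diag r (\<lambda>i. \<tau> i * \<mu> i) = 1\<^sub>m r"
    using \<tau> by (auto simp: mat_diag_def mult.commute intro!: eq_matI)
  have c: "G \<in> carrier_mat m n" "G0 \<in> carrier_mat m n" "Y \<in> carrier_mat n m"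
    "J k \<in> carrier_mat m m" "J l \<in> carrier_mat n n"
    using S m n by (auto simp: G_def G0_def Y_def J_def)
  have GY: "G * Y = J k" "Y * G = J l" "J k * G = G0" "J l * Y = Y"
    unfolding G_def G0_def Y_def J_def
    using block_diag_mult[of "mat_diag r \<mu>" r "mat_diag r \<tau>" S k l "0\<^sub>m l k" k]
      block_diag_mult[of "mat_diag r \<tau>" r "mat_diag r \<mu>" "0\<^sub>m l k" l k S l]
      block_diag_mult[of "1\<^sub>m r" r "mat_diag r \<mu>" "0\<^sub>m k k" k k S l]
      block_diag_mult[of "1\<^sub>m r" r "mat_diag r \<tau>" "0\<^sub>m l l" l l "0\<^sub>m l k" k] S
      left_mult_one_mat[OF mat_diag_dim]
    by (simp_all add: d1)
  have hG: "map_mat std_part G0 = map_mat std_part G"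
  proof -
    have "map_mat std_part S = 0\<^sub>m k l"
    proof (rule eq_matI)
      fix i j assume "i < dim_row (0\<^sub>m k l :: complex mat)" "j < dim_col (0\<^sub>m k l :: complex mat)"
      then show "map_mat std_part S $$ (i, j) = 0\<^sub>m k l $$ (i, j)"
        using S diag inf by (cases "i = j") (auto simp: diagonal_mat_def pos_infinitesimal_def)
    qed (use S in auto)
    moreover have "map_mat std_part (0\<^sub>m k l) = 0\<^sub>m k l"
      by (intro eq_matI) auto
    moreover have "map_mat std_part (four_block_mat (mat_diag r \<mu>) (0\<^sub>m r l) (0\<^sub>m k r) T) =
        four_block_mat (map_mat std_part (mat_diag r \<mu>)) (map_mat std_part (0\<^sub>m r l))
          (map_mat std_part (0\<^sub>m k r)) (map_mat std_part T)"
      if "T \<in> carrier_mat k l" for T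
      by (rule map_four_block_mat) (use that in auto)
    ultimately show ?thesis
      unfolding G_def G0_def using S by simp
  qed
  \<comment> \<open>The two inner unitary factors cancel, so products of A and X reduce to products
    of their middle factors.\<close>
  have sandwich: "(P * K * adj Q) * (Q * L * adj R) = P * (K * L) * adj R"
    if "P \<in> carrier_mat a a" "unitary_mat b Q" "R \<in> carrier_mat c c" "K \<in> carrier_mat a b" "L \<in> carrier_mat b c"
    for P Q R K L a b c
  proof -
    note Q = unitary_matD[OF that(2)]
    have aR: "adj R \<in> carrier_mat c c" using that by simp
    note dims = carrier_matD[OF that(1)] carrier_matD[OF Q(1)] carrier_matD[OF Q(2)]
      carrier_matD[OF aR] carrier_matD[OF that(4)] carrier_matD[OF that(5)] index_mult_mat(2,3)
    have "(P * K * adj Q) * (Q * L * adj R) = P * K * (adj Q * (Q * (L * adj R)))"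
      by (simp only: assoc_mult_mat_dim dims)
    also have "\<dots> = P * K * (L * adj R)"
      using unitary_mat_cancel(1)[OF that(2) mult_carrier_mat[OF that(5) aR]] by simp
    also have "\<dots> = P * (K * L) * adj R"
      by (simp only: assoc_mult_mat_dim dims)
    finally show ?thesis .
  qed
  define X where "X = V * Y * adj U"
  have AG: "A = U * G * adj V" using AS by (simp add: G_def)
  have AX: "A * X = U * J k * adj U" and XA: "X * A = V * J l * adj V"
    unfolding AG X_def using sandwich[OF U'(1) V U'(1) c(1,3)] sandwich[OF V'(1) U V'(1) c(3,1)]
    by (simp_all add: GY)
  have AXA: "A * X * A = U * G0 * adj V"
    unfolding AX unfolding AG using sandwich[OF U'(1) U V'(1) c(4,1)] by (simp add: GY)
  have XAX: "X * A * X = X"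
    unfolding XA unfolding X_def using sandwich[OF V'(1) V U'(1) c(5,3)] by (simp add: GY)
  have herm: "adj (P * K * adj P) = P * K * adj P"
    if "P \<in> carrier_mat a a" "K \<in> carrier_mat a a" "adj K = K" for P K a
    using adj_conjugation[OF that(2,3), of "adj P"] that(1) by simp
  have adjJ: "adj (J k) = J k" for k
    unfolding J_def by (simp add: adj_four_block_mat[of _ r r _ k _ k])
  have "map_mat std_part (A * X * A) = map_mat std_part A"
    unfolding AXA unfolding AG using U' V' c
    by (simp add: std.mat_hom_mult[of _ m m _ n] std.mat_hom_mult[of _ m n _ n] hG del: assoc_mult_mat)
  moreover have "X \<in> carrier_mat n m" using U' V' c by (simp add: X_def)
  ultimately have "weak_ndmpi A X"
    using A XAX herm[OF U'(1) c(4) adjJ] herm[OF V'(1) c(5) adjJ] by (simp add: weak_ndmpi_def AX XA)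
  then show ?thesis
    using AXA that by (simp add: G0_def k_def l_def)
qed

text \<open>Each decomposition yields an essential part of the form A X' A with X' a weak inverse,
  and such products all agree. So the definite description denotes, whatever decomposition is
  chosen.\<close>

lemma essential_part_eq:
  assumes A: "A \<in> carrier_mat m n" and X: "weak_ndmpi A X"
  shows "essential_part A = A * X * A"
proof -
  have eq: "E = A * X * A" if ess: "is_essential_part A E" for E
  proof -
    obtain U r \<mu> S V where svd: "is_svd A U r \<mu> S V" and
      E: "E = U * four_block_mat (mat_diag r \<mu>) (0\<^sub>m r (n - r)) (0\<^sub>m (m - r) r) (0\<^sub>m (m - r) (n - r)) * adj V"
      using ess unfolding is_essential_part_def Let_def carrier_matD[OF A] by blast
    obtain X' where "weak_ndmpi A X'" "A * X' * A = E"
      using svd_weak_ndmpi[OF svd A] E by metis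
    then show ?thesis
      using weak_ndmpi_essential_unique[OF A _ X] by simp
  qed
  obtain U r \<mu> S V where "is_svd A U r \<mu> S V"
    using svd_exists[OF A] by blast
  then have "\<exists>E. is_essential_part A E"
    unfolding is_essential_part_def Let_def by blast
  then show ?thesis
    unfolding essential_part_def using eq by (intro the_equality) auto
qed

section \<open>Identification of the NDMPI with the weak inverse\<close>

lemma weak_ndmpi_exists:
  assumes A: "A \<in> carrier_mat m n"
  obtains X where "weak_ndmpi A X"
  using svd_exists[OF A] svd_weak_ndmpi[OF _ A] by metis

text \<open>The essential part has the standard part of \<open>A\<close>, as seen from any weak
  inverse; conversely, every weak inverse \<open>X\<close> satisfies A X A =
  \<open>essential_part A\<close>.\<close>

lemma is_ndmpi_iff_weak:
  assumes A: "A \<in> carrier_mat m n"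
  shows "is_ndmpi A X \<longleftrightarrow> weak_ndmpi A X"
proof
  assume X: "is_ndmpi A X"
  obtain Y where Y: "weak_ndmpi A Y" using weak_ndmpi_exists[OF A] .
  have "map_mat std_part (essential_part A) = map_mat std_part A"
    using essential_part_eq[OF A Y] Y by (simp add: weak_ndmpi_def)
  with X show "weak_ndmpi A X" by (simp add: is_ndmpi_def weak_ndmpi_def)
next
  assume X: "weak_ndmpi A X"
  then show "is_ndmpi A X"
    using essential_part_eq[OF A X] by (simp add: is_ndmpi_def weak_ndmpi_def)
qed

lemma ndmpi_eqI:
  assumes "A \<in> carrier_mat m n" "weak_ndmpi A X"
  shows "ndmpi A = X"
  unfolding ndmpi_def is_ndmpi_iff_weak[OF assms(1)]
  using assms weak_ndmpi_unique by blast

lemma weak_ndmpi_ndmpi: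
  assumes "A \<in> carrier_mat m n"
  shows "weak_ndmpi A (ndmpi A)"
  using weak_ndmpi_exists[OF assms] ndmpi_eqI[OF assms] by metis

theorem theorem3p7:
  fixes A B :: "dcomplex mat" and m q n :: nat
  assumes "A \<in> carrier_mat m q"
    and "B \<in> carrier_mat q n"
    and "ndmpi A * A * B * ndmpi B = B * ndmpi B * ndmpi A * A"
    and "adj (A * B * ndmpi B * ndmpi A) = A * B * ndmpi B * ndmpi A"
    and "adj (ndmpi B * ndmpi A * A * B) = ndmpi B * ndmpi A * A * B"
  shows "ndmpi (A * B) = ndmpi B * ndmpi A"
proof -
  define X Y where "X = ndmpi A" and "Y = ndmpi B"
  note A = assms(1) and B = assms(2)
  have X: "X \<in> carrier_mat q m" "X * A * X = X" "map_mat std_part (A * X * A) = map_mat std_part A"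
    using weak_ndmpi_ndmpi[OF A] A by (auto simp: weak_ndmpi_def X_def)
  have Y: "Y \<in> carrier_mat n q" "Y * B * Y = Y" "map_mat std_part (B * Y * B) = map_mat std_part B"
    using weak_ndmpi_ndmpi[OF B] B by (auto simp: weak_ndmpi_def Y_def)
  note dims = carrier_matD[OF A] carrier_matD[OF B] carrier_matD[OF X(1)] carrier_matD[OF Y(1)]
    index_mult_mat(2,3)
  have comm: "X * A * B * Y = B * Y * X * A"
    using assms(3) by (simp add: X_def Y_def)
  have "weak_ndmpi (A * B) (Y * X)"
    unfolding weak_ndmpi_def
  proof (intro conjI)
    show "Y * X \<in> carrier_mat (dim_col (A * B)) (dim_row (A * B))"
      using A B X Y by simp
    \<comment> \<open>Exchanging the projections B Y and X A separates the product into the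
      essential parts of \<open>A\<close> and \<open>B\<close>, which agree with them in the
      standard part.\<close>
    have "A * B * (Y * X) * (A * B) = A * (B * Y * X * A) * B"
      by (simp only: assoc_mult_mat_dim dims)
    also have "\<dots> = (A * X * A) * (B * Y * B)"
      unfolding comm[symmetric] by (simp only: assoc_mult_mat_dim dims)
    finally have *: "A * B * (Y * X) * (A * B) = (A * X * A) * (B * Y * B)" .
    have "A * X * A \<in> carrier_mat m q" "B * Y * B \<in> carrier_mat q n"
      using A B X Y by auto
    then show "map_mat std_part (A * B * (Y * X) * (A * B)) = map_mat std_part (A * B)"
      unfolding * by (simp only: std.mat_hom_mult X Y std.mat_hom_mult[OF A B])
    \<comment> \<open>The same exchange in the opposite direction separates the factors Y B Y and X
      A X.\<close>
    have "Y * X * (A * B) * (Y * X) = Y * (X * A * B * Y) * X"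
      by (simp only: assoc_mult_mat_dim dims)
    also have "\<dots> = (Y * B * Y) * (X * A * X)"
      unfolding comm by (simp only: assoc_mult_mat_dim dims)
    finally show "Y * X * (A * B) * (Y * X) = Y * X"
      unfolding X Y .
    have "A * B * (Y * X) = A * B * Y * X" "Y * X * (A * B) = Y * X * A * B"
      by (simp_all only: assoc_mult_mat_dim dims)
    then show "adj (A * B * (Y * X)) = A * B * (Y * X)" "adj (Y * X * (A * B)) = Y * X * (A * B)"
      using assms(4,5) by (simp_all add: X_def Y_def)
  qed
  from ndmpi_eqI[OF mult_carrier_mat[OF A B] this] show ?thesis
    by (simp add: X_def Y_def)
qed

end
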